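(* Let $\mu_0,\mu_1$ be two periodic positive measures defined respectively on $U_0=\mathbb{R}$ and $U_1=\mathbb{R}$, with unit mass in each period, and let $F_i\colon U_i\to V_i=\mathbb{R}$, $i=0,1$, be their distribution functions. Let $c\colon U_0\times U_1\to\mathbb{R}$ be a lower semicontinuous cost function satisfying the Monge condition $c(x_1,y_1)+c(x_2,y_2)<c(x_1,y_2)+c(x_2,y_1)$ whenever $x_1<x_2$ and $y_1<y_2$. Then: (1) any $c_{[F_0,F_1]}$-locally optimal normal transport plan on $V_0\times V_1$ is equivalent to a normal transport plan $\nu_\theta$ with $\operatorname{supp}\nu_\theta=\{(v,w)\colon w=v+\theta\}$ for some real $\theta$; (2) conversely, $\nu_\theta$ is $c_{[F_0,F_1]}$-locally optimal for any real $\theta$; (3) all $c$-locally optimal transport plans on $U_0\times U_1$ with marginals $\mu_0,\mu_1$ are of the form $\gamma_\theta=(\nu_\theta)^{[F_0,F_1]}$.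
   Context: All measures are Borel; $U_0,U_1,V_0,V_1$ denote copies of $\mathbb{R}$. A measure $\mu$ on $\mathbb{R}$ is periodic if $\mu(A+n)=\mu(A)$ for every integer $n$ and Borel set $A$; unit mass in each period means $\mu((x,x+1])=1$ for all $x$. Distribution function: $F_\mu(0)=0$, $F_\mu(x)=\mu((0,x])$ for $x>0$, $F_\mu(x)=-\mu((x,0])$ for $x<0$; write $F_i=F_{\mu_i}$. Inverse: $F_\mu^{-1}(y)=\inf\{x\colon y<F_\mu(x)\}$. For sets, $F_\mu(\{x\})$ denotes $[F_\mu(x-0),F_\mu(x)]$ and $F_\mu(A)=\bigcup_{x\in A}F_\mu(\{x\})$. A (locally finite) transport plan with marginals $\mu_0,\mu_1$ (locally finite measures on $\mathbb{R}$) is a locally finite positive measure $\gamma$ on $\mathbb{R}\times\mathbb{R}$ such that (i) for any $x\in\mathbb{R}$ the supports of the measures $\gamma((-\infty,x]\times\cdot)$ and $\gamma(\cdot\times(-\infty,x])$ are bounded from above and the supports of $\gamma((x,\infty)\times\cdot)$ and $\gamma(\cdot\times(x,\infty))$ are bounded from below; (ii) $\gamma(A\times\mathbb{R})=\mu_0(A)$ and $\gamma(\mathbb{R}\times B)=\mu_1(B)$ for all Borel $A,B$. A local modification of a transport plan $\gamma$ is a transport plan $\gamma'$ with the same marginals such that $\gamma'-\gamma$ is a compactly supported finite signed measure. It is cost-reducing for a cost $c$ if $\iint c(x,y)\,(\gamma'(dx\times dy)-\gamma(dx\times dy))<0$. A plan is $c$-locally optimal if it has no cost-reducing local modifications. A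 transport plan on $V_0\times V_1$ whose marginals are both the Lebesgue measure is called normal. The conjugate of a normal plan $\nu$ is the transport plan $\nu^{[F_0,F_1]}$ on $U_0\times U_1$ such that $\nu^{[F_0,F_1]}(A\times B)=\nu(F_0(A)\times F_1(B))$ for all Borel $A,B$. Two normal plans are equivalent if they have the same conjugate. The conjugate cost is $c_{[F_0,F_1]}(v_0,v_1)=c(F_0^{-1}(v_0),F_1^{-1}(v_1))$; a normal plan $\nu$ is called $c_{[F_0,F_1]}$-locally optimal if there is no normal plan $\nu'$ such that $\nu'-\nu$ is a compactly supported finite signed measure and $\iint c_{[F_0,F_1]}(v,w)\,(\nu'(dv\times dw)-\nu(dv\times dw))<0$ (although $c_{[F_0,F_1]}$ may satisfy the Monge condition only with non-strict inequality). *)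

theory Defs
  imports "HOL-Analysis.Analysis"
begin

definition locally_finite_measure :: "'a::topological_space measure \<Rightarrow> bool" where
  "locally_finite_measure M \<longleftrightarrow>
     sets M = sets borel \<and> (\<forall>x. \<exists>U. open U \<and> x \<in> U \<and> emeasure M U < \<infinity>)"

definition measure_support :: "'a::topological_space measure \<Rightarrow> 'a set" where
  "measure_support M = {x. \<forall>U. open U \<longrightarrow> x \<in> U \<longrightarrow> emeasure M U > 0}"

definition periodic_measure :: "real measure \<Rightarrow> bool" where
  "periodic_measure \<mu> \<longleftrightarrow> sets \<mu> = sets borel \<and>
     (\<forall>(n::int). \<forall>A\<in>sets borel. emeasure \<mu> ((\<lambda>x. x + of_int n) ` A) = emeasure \<mu> A)"

definition unit_mass_per_period :: "real measure \<Rightarrow> bool" where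
  "unit_mass_per_period \<mu> \<longleftrightarrow> (\<forall>x. emeasure \<mu> {x<..x+1} = 1)"

definition dist_fun :: "real measure \<Rightarrow> real \<Rightarrow> real" where
  "dist_fun \<mu> x =
     (if x = 0 then 0 else if 0 < x then measure \<mu> {0<..x} else - measure \<mu> {x<..0})"

definition dist_fun_inv :: "real measure \<Rightarrow> real \<Rightarrow> real" where
  "dist_fun_inv \<mu> y = Inf {x. y < dist_fun \<mu> x}"

text \<open>The image of a set under the distribution function viewed as a set-valued map: each point
  \<open>x\<close> is sent to the whole interval from the left limit at \<open>x\<close> to the value at \<open>x\<close>, so that
  atoms are spread over intervals.\<close>

definition dist_fun_image :: "real measure \<Rightarrow> real set \<Rightarrow> real set" where
  "dist_fun_image \<mu> A =
     (\<Union>x\<in>A. {Lim (at_left x) (dist_fun \<mu>) .. dist_fun \<mu> x})"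

definition fst_slice :: "(real \<times> real) measure \<Rightarrow> real set \<Rightarrow> real measure" where
  "fst_slice \<gamma> A = distr (restrict_space \<gamma> (A \<times> UNIV)) borel snd"

definition snd_slice :: "(real \<times> real) measure \<Rightarrow> real set \<Rightarrow> real measure" where
  "snd_slice \<gamma> B = distr (restrict_space \<gamma> (UNIV \<times> B)) borel fst"

lemma emeasure_fst_slice:
  assumes "sets \<gamma> = sets borel" "A \<in> sets borel" "B \<in> sets borel"
  shows "emeasure (fst_slice \<gamma> A) B = emeasure \<gamma> (A \<times> B)"
proof -
  have sp: "space \<gamma> = UNIV" using sets_eq_imp_space_eq[OF assms(1)] by simp
  have m: "snd \<in> measurable (restrict_space \<gamma> (A \<times> UNIV)) borel"
    by (intro measurable_restrict_space1)
       (simp add: measurable_cong_sets[OF assms(1) refl] borel_measurable_continuous_onI continuous_on_snd)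
  have A: "A \<times> UNIV \<inter> space \<gamma> \<in> sets \<gamma>"
    using assms(1,2) by (simp add: sp borel_Times)
  have eq: "snd -` B \<inter> space (restrict_space \<gamma> (A \<times> UNIV)) = A \<times> B"
    by (auto simp: space_restrict_space sp)
  show ?thesis
    unfolding fst_slice_def
    by (subst emeasure_distr[OF m assms(3)], subst eq, subst emeasure_restrict_space[OF A]) auto
qed

lemma emeasure_snd_slice:
  assumes "sets \<gamma> = sets borel" "A \<in> sets borel" "B \<in> sets borel"
  shows "emeasure (snd_slice \<gamma> B) A = emeasure \<gamma> (A \<times> B)"
proof -
  have sp: "space \<gamma> = UNIV" using sets_eq_imp_space_eq[OF assms(1)] by simp
  have m: "fst \<in> measurable (restrict_space \<gamma> (UNIV \<times> B)) borel"
    by (intro measurable_restrict_space1)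
       (simp add: measurable_cong_sets[OF assms(1) refl] borel_measurable_continuous_onI continuous_on_fst)
  have B: "UNIV \<times> B \<inter> space \<gamma> \<in> sets \<gamma>"
    using assms(1,3) by (simp add: sp borel_Times)
  have eq: "fst -` A \<inter> space (restrict_space \<gamma> (UNIV \<times> B)) = A \<times> B"
    by (auto simp: space_restrict_space sp)
  show ?thesis
    unfolding snd_slice_def
    by (subst emeasure_distr[OF m assms(2)], subst eq, subst emeasure_restrict_space[OF B]) auto
qed

definition transport_plan ::
    "real measure \<Rightarrow> real measure \<Rightarrow> (real \<times> real) measure \<Rightarrow> bool" where
  "transport_plan \<mu>0 \<mu>1 \<gamma> \<longleftrightarrow>
     locally_finite_measure \<mu>0 \<and> locally_finite_measure \<mu>1 \<and> locally_finite_measure \<gamma> \<and>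
     (\<forall>x. bdd_above (measure_support (fst_slice \<gamma> {..x})) \<and>
          bdd_above (measure_support (snd_slice \<gamma> {..x})) \<and>
          bdd_below (measure_support (fst_slice \<gamma> {x<..})) \<and>
          bdd_below (measure_support (snd_slice \<gamma> {x<..}))) \<and>
     (\<forall>A\<in>sets borel. emeasure \<gamma> (A \<times> UNIV) = emeasure \<mu>0 A) \<and>
     (\<forall>B\<in>sets borel. emeasure \<gamma> (UNIV \<times> B) = emeasure \<mu>1 B)"

text \<open>\<open>\<gamma>' - \<gamma>\<close> is a compactly supported finite signed measure, whose Jordan decomposition is
  \<open>\<sigma>p - \<sigma>n\<close>.  The identity is stated additively because \<open>\<gamma>\<close> and \<open>\<gamma>'\<close> may be infinite.\<close>

definition compact_finite_diff ::
    "(real \<times> real) measure \<Rightarrow> (real \<times> real) measure \<Rightarrow>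
     (real \<times> real) measure \<Rightarrow> (real \<times> real) measure \<Rightarrow> bool" where
  "compact_finite_diff \<gamma>' \<gamma> \<sigma>p \<sigma>n \<longleftrightarrow>
     sets \<sigma>p = sets borel \<and> sets \<sigma>n = sets borel \<and>
     finite_measure \<sigma>p \<and> finite_measure \<sigma>n \<and>
     (\<exists>S\<in>sets borel. emeasure \<sigma>p (- S) = 0 \<and> emeasure \<sigma>n S = 0) \<and>
     (\<exists>K. compact K \<and> emeasure \<sigma>p (- K) = 0 \<and> emeasure \<sigma>n (- K) = 0) \<and>
     (\<forall>A\<in>sets borel. emeasure \<gamma>' A + emeasure \<sigma>n A = emeasure \<gamma> A + emeasure \<sigma>p A)"

definition local_modification ::
    "real measure \<Rightarrow> real measure \<Rightarrow> (real \<times> real) measure \<Rightarrow> (real \<times> real) measure \<Rightarrow> bool" where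
  "local_modification \<mu>0 \<mu>1 \<gamma> \<gamma>' \<longleftrightarrow>
     transport_plan \<mu>0 \<mu>1 \<gamma> \<and> transport_plan \<mu>0 \<mu>1 \<gamma>' \<and>
     (\<exists>\<sigma>p \<sigma>n. compact_finite_diff \<gamma>' \<gamma> \<sigma>p \<sigma>n)"

text \<open>The integral of \<open>c\<close> against \<open>\<sigma>p - \<sigma>n\<close> exists in the extended reals and is negative.  The two
  sides of the inequality are the integrals of the positive and of the negative part of
  \<open>c d(\<sigma>p - \<sigma>n)\<close>; strict inequality forces the former to be finite, so no difference of infinities
  arises.\<close>

definition signed_integral_neg ::
    "(real \<times> real \<Rightarrow> real) \<Rightarrow> (real \<times> real) measure \<Rightarrow> (real \<times> real) measure \<Rightarrow> bool" where
  "signed_integral_neg c \<sigma>p \<sigma>n \<longleftrightarrow>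
     (\<integral>\<^sup>+z. ennreal (c z) \<partial>\<sigma>p) + (\<integral>\<^sup>+z. ennreal (- c z) \<partial>\<sigma>n)
       < (\<integral>\<^sup>+z. ennreal (- c z) \<partial>\<sigma>p) + (\<integral>\<^sup>+z. ennreal (c z) \<partial>\<sigma>n)"

definition cost_reducing ::
    "(real \<times> real \<Rightarrow> real) \<Rightarrow> (real \<times> real) measure \<Rightarrow> (real \<times> real) measure \<Rightarrow> bool" where
  "cost_reducing c \<gamma> \<gamma>' \<longleftrightarrow>
     (\<exists>\<sigma>p \<sigma>n. compact_finite_diff \<gamma>' \<gamma> \<sigma>p \<sigma>n \<and> signed_integral_neg c \<sigma>p \<sigma>n)"

definition locally_optimal ::
    "real measure \<Rightarrow> real measure \<Rightarrow> (real \<times> real \<Rightarrow> real) \<Rightarrow> (real \<times> real) measure \<Rightarrow> bool" where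
  "locally_optimal \<mu>0 \<mu>1 c \<gamma> \<longleftrightarrow>
     transport_plan \<mu>0 \<mu>1 \<gamma> \<and>
     \<not> (\<exists>\<gamma>'. local_modification \<mu>0 \<mu>1 \<gamma> \<gamma>' \<and> cost_reducing c \<gamma> \<gamma>')"

definition lower_semicontinuous :: "('a::topological_space \<Rightarrow> real) \<Rightarrow> bool" where
  "lower_semicontinuous f \<longleftrightarrow> (\<forall>x. \<forall>a < f x. \<forall>\<^sub>F y in nhds x. a < f y)"

definition monge :: "(real \<times> real \<Rightarrow> real) \<Rightarrow> bool" where
  "monge c \<longleftrightarrow>
     (\<forall>x1 x2 y1 y2. x1 < x2 \<longrightarrow> y1 < y2 \<longrightarrow>
        c (x1, y1) + c (x2, y2) < c (x1, y2) + c (x2, y1))"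

definition normal_plan :: "(real \<times> real) measure \<Rightarrow> bool" where
  "normal_plan \<nu> \<longleftrightarrow> transport_plan lborel lborel \<nu>"

text \<open>\<open>conjugate_plan \<mu>0 \<mu>1 \<nu> \<gamma>\<close> says that \<open>\<gamma>\<close> is the conjugate of \<open>\<nu>\<close> with respect to the
  distribution functions of \<open>\<mu>0\<close> and \<open>\<mu>1\<close>.  Such a \<open>\<gamma>\<close> is determined by its values on rectangles;
  conjugation is kept as a relation so that a statement about the conjugate asserts its existence.\<close>

definition conjugate_plan ::
    "real measure \<Rightarrow> real measure \<Rightarrow> (real \<times> real) measure \<Rightarrow> (real \<times> real) measure \<Rightarrow> bool" where
  "conjugate_plan \<mu>0 \<mu>1 \<nu> \<gamma> \<longleftrightarrow>
     transport_plan \<mu>0 \<mu>1 \<gamma> \<and>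
     (\<forall>A\<in>sets borel. \<forall>B\<in>sets borel.
        emeasure \<gamma> (A \<times> B) = emeasure \<nu> (dist_fun_image \<mu>0 A \<times> dist_fun_image \<mu>1 B))"

definition equivalent_plans ::
    "real measure \<Rightarrow> real measure \<Rightarrow> (real \<times> real) measure \<Rightarrow> (real \<times> real) measure \<Rightarrow> bool" where
  "equivalent_plans \<mu>0 \<mu>1 \<nu> \<nu>' \<longleftrightarrow>
     normal_plan \<nu> \<and> normal_plan \<nu>' \<and>
     (\<exists>\<gamma>. conjugate_plan \<mu>0 \<mu>1 \<nu> \<gamma> \<and> conjugate_plan \<mu>0 \<mu>1 \<nu>' \<gamma>)"

definition conjugate_cost ::
    "real measure \<Rightarrow> real measure \<Rightarrow> (real \<times> real \<Rightarrow> real) \<Rightarrow> real \<times> real \<Rightarrow> real" where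
  "conjugate_cost \<mu>0 \<mu>1 c = (\<lambda>(v, w). c (dist_fun_inv \<mu>0 v, dist_fun_inv \<mu>1 w))"

definition shift_plan :: "real \<Rightarrow> (real \<times> real) measure \<Rightarrow> bool" where
  "shift_plan \<theta> \<nu> \<longleftrightarrow> normal_plan \<nu> \<and> measure_support \<nu> = {(v, w). w = v + \<theta>}"

end

theory Submission
  imports Defs
begin

text \<open>That every locally optimal plan comes from a line \<open>w = v + \<theta>\<close> rests on its monotonicity.  If it
  charged both \<open>{..x} \<times> {y<..}\<close> and \<open>{x<..} \<times> {..y}\<close>, then pairs of points from the two quadrants
  could exchange their partners; by the Monge condition every single exchange lowers the cost, so
  lower semicontinuity is needed only for measurability and for lower bounds on compact sets
  (\<open>locally_optimal_separated\<close>).  The difference of the masses of these quadrants is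
  determined by the marginals up to one constant \<open>\<theta>\<close> (\<open>flux_formula\<close>).  As one of the two
  masses is zero, the mass of \<open>{..x} \<times> {y<..}\<close> is the positive part of \<open>F0 x - F1 y + \<theta>\<close>.  This
  determines the plan, and the conjugate of the Lebesgue measure on the line \<open>w = v + \<theta>\<close> has the same
  quadrant masses (\<open>monotone_plan_conjugate_shift\<close>).  The argument applies directly to a locally optimal
  plan with marginals \<open>\<mu>0\<close> and \<open>\<mu>1\<close>, and to the conjugate of a locally optimal normal plan.

  Conjugates are handled as push-forwards under the inverse distribution functions.  Set-valued images and
  preimages under the inverse differ by countable sets, which are null for plans with Lebesgue
  marginals (\<open>conjugate_plan_iff\<close>).

  For the local optimality of the plan on \<open>w = v + \<theta>\<close>, let \<open>\<sigma>p - \<sigma>n\<close> be the compactly supported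
  difference between another normal plan and this one.  Both parts have the same marginals, and \<open>\<sigma>n\<close> lives
  on the line.  On a bounded region, a weakly Monge cost that is bounded below admits potentials
  \<open>p\<close> and \<open>q\<close> with \<open>p v + q w \<le> c (v, w)\<close> and equality on
  the line (\<open>monge_potentials\<close>), so the cost integral of \<open>\<sigma>n\<close> cannot exceed that of \<open>\<sigma>p\<close>.  The potentials
  come from a supremum over finite chains (\<open>diagonal_potential\<close>), which is monotone and therefore
  measurable, and they are bounded below, which keeps the comparison meaningful when integrals are infinite.\<close>

section \<open>Supports, slices and rectangles\<close>

lemma emeasure_Compl_measure_support:
  fixes M :: "'a::second_countable_topology measure"
  assumes "sets M = sets borel"
  shows "emeasure M (- measure_support M) = 0"
proof -
  let ?F = "{U. open U \<and> emeasure M U = 0}"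
  obtain F' where F': "F' \<subseteq> ?F" "countable F'" "\<Union>F' = \<Union>?F"
    using Lindelof[of ?F] by auto
  have "- measure_support M = \<Union>?F"
    by (auto simp: measure_support_def not_gr_zero)
  also have "\<dots> = (\<Union>U\<in>F'. U)" using F'(3) by simp
  finally have eq: "- measure_support M = (\<Union>U\<in>F'. U)" .
  have "(\<Union>U\<in>F'. U) \<in> null_sets M"
    using F'(1,2) assms by (intro null_sets_UN') (auto simp: null_sets_def)
  then show ?thesis by (simp add: eq null_sets_def)
qed

lemma bdd_above_measure_support_iff:
  fixes M :: "real measure"
  assumes "sets M = sets borel"
  shows "bdd_above (measure_support M) \<longleftrightarrow> (\<exists>y. emeasure M {y<..} = 0)"
proof
  assume "bdd_above (measure_support M)"
  then obtain b where "measure_support M \<subseteq> {..b}" by (auto simp: bdd_above_def)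
  then have "{b<..} \<subseteq> - measure_support M" by auto
  moreover have "- measure_support M \<in> sets M"
  proof -
    have "open (- measure_support M)"
      unfolding measure_support_def by (subst open_subopen) (auto simp: not_gr_zero)
    then show ?thesis using assms by simp
  qed
  ultimately have "emeasure M {b<..} \<le> 0"
    using emeasure_mono emeasure_Compl_measure_support[OF assms] by metis
  then show "\<exists>y. emeasure M {y<..} = 0" by auto
next
  assume "\<exists>y. emeasure M {y<..} = 0"
  then obtain y where y: "emeasure M {y<..} = 0" ..
  have "x \<le> y" if "x \<in> measure_support M" for x
  proof (rule ccontr)
    assume "\<not> x \<le> y"
    then have "emeasure M {y<..} > 0" using that by (auto simp: measure_support_def)
    then show False using y by simp
  qed
  then show "bdd_above (measure_support M)" by (rule bdd_aboveI)
qed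

lemma bdd_below_measure_support_iff:
  fixes M :: "real measure"
  assumes "sets M = sets borel"
  shows "bdd_below (measure_support M) \<longleftrightarrow> (\<exists>y. emeasure M {..<y} = 0)"
proof
  assume "bdd_below (measure_support M)"
  then obtain b where "measure_support M \<subseteq> {b..}" by (auto simp: bdd_below_def)
  then have "{..<b} \<subseteq> - measure_support M" by auto
  moreover have "- measure_support M \<in> sets M"
  proof -
    have "open (- measure_support M)"
      unfolding measure_support_def by (subst open_subopen) (auto simp: not_gr_zero)
    then show ?thesis using assms by simp
  qed
  ultimately have "emeasure M {..<b} \<le> 0"
    using emeasure_mono emeasure_Compl_measure_support[OF assms] by metis
  then show "\<exists>y. emeasure M {..<y} = 0" by auto
next
  assume "\<exists>y. emeasure M {..<y} = 0"
  then obtain y where y: "emeasure M {..<y} = 0" ..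
  have "y \<le> x" if "x \<in> measure_support M" for x
  proof (rule ccontr)
    assume "\<not> y \<le> x"
    then have "emeasure M {..<y} > 0" using that by (auto simp: measure_support_def)
    then show False using y by simp
  qed
  then show "bdd_below (measure_support M)" by (rule bdd_belowI)
qed

lemma sets_fst_slice [simp]: "sets (fst_slice \<gamma> A) = sets borel"
  and sets_snd_slice [simp]: "sets (snd_slice \<gamma> A) = sets borel"
  by (simp_all add: fst_slice_def snd_slice_def)

text \<open>The conditions on the supports of the slices say that the plan vanishes on quadrants of the four
  kinds below once they are far enough out.  Local finiteness of the plan need not be required
  separately: it follows from that of the first marginal.\<close>

lemma transport_plan_iff:
  "transport_plan \<mu>0 \<mu>1 \<gamma> \<longleftrightarrow>
     locally_finite_measure \<mu>0 \<and> locally_finite_measure \<mu>1 \<and> sets \<gamma> = sets borel \<and>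
     (\<forall>x. (\<exists>y. emeasure \<gamma> ({..x} \<times> {y<..}) = 0) \<and> (\<exists>y. emeasure \<gamma> ({y<..} \<times> {..x}) = 0) \<and>
          (\<exists>y. emeasure \<gamma> ({x<..} \<times> {..<y}) = 0) \<and> (\<exists>y. emeasure \<gamma> ({..<y} \<times> {x<..}) = 0)) \<and>
     (\<forall>A\<in>sets borel. emeasure \<gamma> (A \<times> UNIV) = emeasure \<mu>0 A) \<and>
     (\<forall>B\<in>sets borel. emeasure \<gamma> (UNIV \<times> B) = emeasure \<mu>1 B)"
proof -
  have lf: "locally_finite_measure \<gamma> \<longleftrightarrow> sets \<gamma> = sets borel"
    if prem: "locally_finite_measure \<mu>0" "\<forall>A\<in>sets borel. emeasure \<gamma> (A \<times> UNIV) = emeasure \<mu>0 A"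
  proof
    assume "sets \<gamma> = sets borel"
    moreover have "\<exists>U. open U \<and> z \<in> U \<and> emeasure \<gamma> U < \<infinity>" for z
    proof -
      obtain U where "open U" "fst z \<in> U" "emeasure \<mu>0 U < \<infinity>"
        using prem(1) by (auto simp: locally_finite_measure_def)
      then show ?thesis using prem(2)
        by (intro exI[of _ "U \<times> UNIV"]) (auto simp: open_Times mem_Times_iff)
    qed
    ultimately show "locally_finite_measure \<gamma>" by (simp add: locally_finite_measure_def)
  qed (simp add: locally_finite_measure_def)
  have "sets \<gamma> = sets borel \<Longrightarrow>
      (bdd_above (measure_support (fst_slice \<gamma> {..x})) \<and>
       bdd_above (measure_support (snd_slice \<gamma> {..x})) \<and>
       bdd_below (measure_support (fst_slice \<gamma> {x<..})) \<and>
       bdd_below (measure_support (snd_slice \<gamma> {x<..}))) \<longleftrightarrow>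
      ((\<exists>y. emeasure \<gamma> ({..x} \<times> {y<..}) = 0) \<and> (\<exists>y. emeasure \<gamma> ({y<..} \<times> {..x}) = 0) \<and>
          (\<exists>y. emeasure \<gamma> ({x<..} \<times> {..<y}) = 0) \<and> (\<exists>y. emeasure \<gamma> ({..<y} \<times> {x<..}) = 0))" for x
    by (simp add: bdd_above_measure_support_iff bdd_below_measure_support_iff
        emeasure_fst_slice emeasure_snd_slice)
  moreover have "locally_finite_measure \<gamma> \<Longrightarrow> sets \<gamma> = sets borel"
    by (simp add: locally_finite_measure_def)
  ultimately show ?thesis
    unfolding transport_plan_def by (intro iffI conjI; elim conjE) (simp_all add: lf)
qed

lemma transport_planD:
  assumes "transport_plan \<mu>0 \<mu>1 \<gamma>"
  shows "sets \<gamma> = sets borel" "space \<gamma> = UNIV"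
    "A \<in> sets borel \<Longrightarrow> emeasure \<gamma> (A \<times> UNIV) = emeasure \<mu>0 A"
    "A \<in> sets borel \<Longrightarrow> emeasure \<gamma> (UNIV \<times> A) = emeasure \<mu>1 A"
proof -
  show *: "sets \<gamma> = sets borel" using assms by (simp add: transport_plan_iff)
  show "space \<gamma> = UNIV" using sets_eq_imp_space_eq[OF *] by simp
qed (use assms in \<open>auto simp: transport_plan_iff\<close>)

lemma measure_eq_of_Ioc:
  fixes M N :: "real measure"
  assumes "sets M = sets borel" "sets N = sets borel"
    and eq: "\<And>a b. emeasure M {a<..b} = emeasure N {a<..b}"
    and fin: "\<And>a b. emeasure M {a<..b} < \<infinity>"
  shows "M = N"
proof (rule measure_eqI_generator_eq[where E = "range (\<lambda>(a, b). {a <.. b::real})" and \<Omega> = UNIV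
      and A = "\<lambda>n::nat. {- real n<..real n}"])
  show "Int_stable (range (\<lambda>(a, b). {a <.. b::real}))"
  proof (rule Int_stableI)
    fix X Y :: "real set"
    assume "X \<in> range (\<lambda>(a, b). {a<..b})" "Y \<in> range (\<lambda>(a, b). {a<..b})"
    then obtain a b c d where "X = {a<..b}" "Y = {c<..d}" by auto
    then have "X \<inter> Y = {max a c<..min b d}" by auto
    then show "X \<inter> Y \<in> range (\<lambda>(a, b). {a<..b})" by auto
  qed
  have "sets (borel::real measure) = sigma_sets UNIV (range (\<lambda>(a, b). {a <.. b::real}))"
    by (subst borel_sigma_sets_Ioc) (simp add: sets_measure_of)
  then show "sets M = sigma_sets UNIV (range (\<lambda>(a, b). {a <.. b::real}))"
      "sets N = sigma_sets UNIV (range (\<lambda>(a, b). {a <.. b::real}))"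
    using assms(1,2) by simp_all
  have "\<exists>n::nat. - real n < x \<and> x \<le> real n" for x
  proof -
    obtain n where "\<bar>x\<bar> < real n" using reals_Archimedean2 by blast
    then show ?thesis by (intro exI[of _ n]) auto
  qed
  then show "(\<Union>i. {- real i<..real i}) = UNIV" by auto
  show "emeasure M {- real i<..real i} \<noteq> \<infinity>" for i using fin[of "- real i" "real i"] by auto
qed (use eq in auto)

text \<open>A measure on the plane with finite mass on bounded vertical strips is determined on Borel rectangles by
  its values on the bounded half-open ones.\<close>

lemma emeasure_rectangle_eq_of_Ioc:
  fixes \<gamma> \<gamma>' :: "(real \<times> real) measure"
  assumes s: "sets \<gamma> = sets borel" "sets \<gamma>' = sets borel"
    and eq: "\<And>a b c d. emeasure \<gamma> ({a<..b} \<times> {c<..d}) = emeasure \<gamma>' ({a<..b} \<times> {c<..d})"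
    and fin: "\<And>a b. emeasure \<gamma> ({a<..b} \<times> UNIV) < \<infinity>"
    and A: "A \<in> sets borel" and B: "B \<in> sets borel"
  shows "emeasure \<gamma> (A \<times> B) = emeasure \<gamma>' (A \<times> B)"
proof -
  have m: "X \<times> Y \<in> sets \<gamma>" if "X \<in> sets borel" "Y \<in> sets borel" for X Y
    using that s borel_Times by metis
  have B_eq: "emeasure \<gamma> ({a<..b} \<times> B) = emeasure \<gamma>' ({a<..b} \<times> B)" for a b
  proof -
    have "fst_slice \<gamma> {a<..b} = fst_slice \<gamma>' {a<..b}"
    proof (rule measure_eq_of_Ioc)
      fix c d :: real
      have "emeasure \<gamma> ({a<..b} \<times> {c<..d}) \<le> emeasure \<gamma> ({a<..b} \<times> UNIV)"
        by (intro emeasure_mono m) auto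
      then show "emeasure (fst_slice \<gamma> {a<..b}) {c<..d} < \<infinity>"
        using fin[of a b] by (simp add: emeasure_fst_slice s)
    qed (simp_all add: emeasure_fst_slice s eq)
    then show ?thesis using emeasure_fst_slice s B
      by (metis sets_borel greaterThanAtMost_borel)
  qed
  have "snd_slice \<gamma> B = snd_slice \<gamma>' B"
  proof (rule measure_eq_of_Ioc)
    fix a b :: real
    have "emeasure \<gamma> ({a<..b} \<times> B) \<le> emeasure \<gamma> ({a<..b} \<times> UNIV)"
      using B by (intro emeasure_mono m) auto
    then show "emeasure (snd_slice \<gamma> B) {a<..b} < \<infinity>"
      using fin[of a b] B by (simp add: emeasure_snd_slice s)
  qed (simp_all add: emeasure_snd_slice s B B_eq)
  then show ?thesis using emeasure_snd_slice s A B by metis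
qed

section \<open>Sums of Borel measures\<close>

text \<open>The setwise sum of two Borel measures.\<close>

definition add_measure :: "'a::topological_space measure \<Rightarrow> 'a measure \<Rightarrow> 'a measure" where
  "add_measure M N = measure_of UNIV (sets borel) (\<lambda>A. emeasure M A + emeasure N A)"

lemma sets_add_measure [simp, measurable_cong]: "sets (add_measure M N) = sets borel"
  and space_add_measure [simp]: "space (add_measure M N) = UNIV"
  using sets.sigma_sets_eq[of "borel :: 'a measure"]
  by (simp_all add: add_measure_def space_measure_of_conv sets_measure_of)

lemma emeasure_add_measure:
  assumes "sets M = sets borel" "sets N = sets borel" "A \<in> sets borel"
  shows "emeasure (add_measure M N) A = emeasure M A + emeasure N A"
proof (rule emeasure_measure_of[OF add_measure_def])
  show "positive (sets (add_measure M N)) (\<lambda>A. emeasure M A + emeasure N A)"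
    by (simp add: positive_def)
  show "countably_additive (sets (add_measure M N)) (\<lambda>A. emeasure M A + emeasure N A)"
  proof (rule countably_additiveI)
    fix X :: "nat \<Rightarrow> 'a set"
    assume X: "range X \<subseteq> sets (add_measure M N)" "disjoint_family X"
    have "(\<Sum>i. emeasure M (X i) + emeasure N (X i)) = (\<Sum>i. emeasure M (X i)) + (\<Sum>i. emeasure N (X i))"
      by (intro suminf_add[symmetric] summableI)
    also have "\<dots> = emeasure M (\<Union>i. X i) + emeasure N (\<Union>i. X i)"
      using X assms by (simp add: suminf_emeasure)
    finally show "(\<Sum>i. emeasure M (X i) + emeasure N (X i)) = emeasure M (\<Union>i. X i) + emeasure N (\<Union>i. X i)" .
  qed
qed (use assms in auto)

lemma nn_integral_add_measure:
  assumes s: "sets M = sets borel" "sets N = sets borel" and f: "f \<in> borel_measurable borel"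
  shows "(\<integral>\<^sup>+x. f x \<partial>add_measure M N) = (\<integral>\<^sup>+x. f x \<partial>M) + (\<integral>\<^sup>+x. f x \<partial>N)"
  using f
proof (induction rule: borel_measurable_induct)
  case (cong f g)
  then show ?case by (simp cong: nn_integral_cong)
next
  case (set A)
  then show ?case using s by (simp add: emeasure_add_measure)
next
  case (mult u c)
  then show ?case using s
    by (simp add: nn_integral_cmult distrib_left measurable_cong_sets[OF s(1) refl]
        measurable_cong_sets[OF s(2) refl] measurable_cong_sets[OF sets_add_measure refl])
next
  case (add u v)
  then show ?case using s
    by (simp add: nn_integral_add measurable_cong_sets[OF s(1) refl]
        measurable_cong_sets[OF s(2) refl] measurable_cong_sets[OF sets_add_measure refl] ac_simps)
next
  case (seq U)
  have "(\<integral>\<^sup>+x. (SUP i. U i) x \<partial>K) = (SUP i. \<integral>\<^sup>+x. U i x \<partial>K)" if "sets K = sets borel" for K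
    unfolding SUP_apply using seq
    by (intro nn_integral_monotone_convergence_SUP) (simp_all add: measurable_cong_sets[OF that refl])
  moreover have "incseq (\<lambda>i. \<integral>\<^sup>+x. U i x \<partial>K)" for K
    using seq by (auto simp: incseq_def le_fun_def intro!: nn_integral_mono)
  ultimately show ?case using s seq by (simp add: ennreal_SUP_add)
qed

section \<open>Local modifications\<close>

lemma emeasure_Icc_finite:
  fixes \<mu> :: "real measure"
  assumes "locally_finite_measure \<mu>"
  shows "emeasure \<mu> {a..b} < \<infinity>"
proof -
  have s: "sets \<mu> = sets borel" using assms by (simp add: locally_finite_measure_def)
  let ?C = "{U. open U \<and> emeasure \<mu> U < \<infinity>}"
  have "{a..b} \<subseteq> \<Union>?C"
  proof
    fix x :: real
    obtain U where "open U" "x \<in> U" "emeasure \<mu> U < \<infinity>"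
      using assms by (auto simp: locally_finite_measure_def)
    then show "x \<in> \<Union>?C" by auto
  qed
  then obtain D where D: "D \<subseteq> ?C" "finite D" "{a..b} \<subseteq> \<Union>D"
    using compactE[of "{a..b}" ?C] compact_Icc by (metis (no_types, lifting) mem_Collect_eq)
  have "emeasure \<mu> {a..b} \<le> emeasure \<mu> (\<Union>U\<in>D. U)"
    using D s by (intro emeasure_mono) (auto intro!: borel_open open_Union)
  also have "\<dots> \<le> (\<Sum>U\<in>D. emeasure \<mu> U)"
    using D s by (intro emeasure_subadditive_finite) auto
  also have "\<dots> < \<infinity>" using D by auto
  finally show ?thesis .
qed

lemma compact_subset_square:
  fixes K :: "(real \<times> real) set"
  assumes "compact K"
  obtains r where "0 \<le> r" "K \<subseteq> {-r..r} \<times> {-r..r}"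
proof -
  obtain r where r: "\<And>z. z \<in> K \<Longrightarrow> norm z \<le> r"
    using compact_imp_bounded[OF assms] by (auto simp: bounded_iff)
  have "z \<in> {-max r 0..max r 0} \<times> {-max r 0..max r 0}" if "z \<in> K" for z
    using r[OF that] norm_fst_le[of "fst z" "snd z"] norm_snd_le[of "snd z" "fst z"]
    by (auto simp: mem_Times_iff)
  then show ?thesis by (intro that[of "max r 0"]) auto
qed

text \<open>Changing a plan on a compact set without touching its marginals yields a plan.\<close>

lemma transport_plan_modification:
  assumes tp: "transport_plan \<mu>0 \<mu>1 \<gamma>" and s': "sets \<gamma>' = sets borel"
    and diff: "compact_finite_diff \<gamma>' \<gamma> \<sigma>p \<sigma>n"
    and m0: "\<And>X. X \<in> sets borel \<Longrightarrow> emeasure \<sigma>p (X \<times> UNIV) = emeasure \<sigma>n (X \<times> UNIV)"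
    and m1: "\<And>X. X \<in> sets borel \<Longrightarrow> emeasure \<sigma>p (UNIV \<times> X) = emeasure \<sigma>n (UNIV \<times> X)"
  shows "transport_plan \<mu>0 \<mu>1 \<gamma>'"
proof -
  note s = transport_planD(1)[OF tp]
  have sp: "sets \<sigma>p = sets borel" and fin: "finite_measure \<sigma>n"
    and eq: "\<And>X. X \<in> sets borel \<Longrightarrow> emeasure \<gamma>' X + emeasure \<sigma>n X = emeasure \<gamma> X + emeasure \<sigma>p X"
    using diff by (auto simp: compact_finite_diff_def)
  have cancel: "emeasure \<gamma>' X = emeasure \<gamma> X"
    if "X \<in> sets borel" "emeasure \<sigma>p X = emeasure \<sigma>n X" for X
    using eq[OF that(1)] that(2) finite_measure.emeasure_finite[OF fin, of X]
    by (metis add.commute ennreal_add_left_cancel infinity_ennreal_def)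
  obtain K where K: "compact K" "emeasure \<sigma>p (- K) = 0"
    using diff by (auto simp: compact_finite_diff_def)
  obtain r where r: "K \<subseteq> {-r..r} \<times> {-r..r}" using compact_subset_square[OF K(1)] by metis
  have zero: "emeasure \<gamma>' X = 0"
    if "X \<in> sets borel" "Y \<in> sets borel" "X \<subseteq> Y" "emeasure \<gamma> Y = 0"
      "X \<inter> {-r..r} \<times> {-r..r} = {}" for X Y
  proof -
    have "emeasure \<gamma> X \<le> emeasure \<gamma> Y" using that s by (intro emeasure_mono) auto
    moreover have "emeasure \<sigma>p X \<le> emeasure \<sigma>p (- K)"
      using that K r sp by (intro emeasure_mono) (auto simp: compact_imp_closed borel_closed)
    ultimately show ?thesis using eq[OF that(1)] that(4) K(2) by simp
  qed
  have rect: "X \<times> Y \<in> sets borel" if "X \<in> sets borel" "Y \<in> sets borel" for X Y :: "real set"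
    using that by (rule borel_Times)
  have "(\<exists>y. emeasure \<gamma>' ({..x} \<times> {y<..}) = 0) \<and> (\<exists>y. emeasure \<gamma>' ({y<..} \<times> {..x}) = 0) \<and>
        (\<exists>y. emeasure \<gamma>' ({x<..} \<times> {..<y}) = 0) \<and> (\<exists>y. emeasure \<gamma>' ({..<y} \<times> {x<..}) = 0)" for x
  proof -
    obtain y1 y2 y3 y4 where "emeasure \<gamma> ({..x} \<times> {y1<..}) = 0" "emeasure \<gamma> ({y2<..} \<times> {..x}) = 0"
        "emeasure \<gamma> ({x<..} \<times> {..<y3}) = 0" "emeasure \<gamma> ({..<y4} \<times> {x<..}) = 0"
      using tp by (auto simp: transport_plan_iff) metis
    note z = this
    have "emeasure \<gamma>' ({..x} \<times> {max y1 r<..}) = 0"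
      by (rule zero[OF _ _ _ z(1)]) (auto intro: rect)
    moreover have "emeasure \<gamma>' ({max y2 r<..} \<times> {..x}) = 0"
      by (rule zero[OF _ _ _ z(2)]) (auto intro: rect)
    moreover have "emeasure \<gamma>' ({x<..} \<times> {..<min y3 (-r)}) = 0"
      by (rule zero[OF _ _ _ z(3)]) (auto intro: rect)
    moreover have "emeasure \<gamma>' ({..<min y4 (-r)} \<times> {x<..}) = 0"
      by (rule zero[OF _ _ _ z(4)]) (auto intro: rect)
    ultimately show ?thesis by blast
  qed
  moreover have "emeasure \<gamma>' (X \<times> UNIV) = emeasure \<mu>0 X" "emeasure \<gamma>' (UNIV \<times> X) = emeasure \<mu>1 X"
    if "X \<in> sets borel" for X
    using that cancel m0 m1 rect transport_planD(3,4)[OF tp] by (simp_all add: rect)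
  ultimately show ?thesis using tp s' by (auto simp: transport_plan_iff)
qed

text \<open>If the cost is bounded below on the region concerned, the sign of its integral against
  \<open>\<sigma>p - \<sigma>n\<close> can be read off after adding a constant that makes it nonnegative there: the total masses
  agree, so the constant contributes the same finite amount to both sides.\<close>

lemma nn_integral_add_const_parts:
  fixes c :: "'a \<Rightarrow> real"
  assumes "c \<in> borel_measurable \<sigma>" and "AE z in \<sigma>. - M \<le> c z" and "0 \<le> M"
  shows "(\<integral>\<^sup>+z. ennreal (c z) \<partial>\<sigma>) + ennreal M * emeasure \<sigma> (space \<sigma>) =
         (\<integral>\<^sup>+z. ennreal (c z + M) \<partial>\<sigma>) + (\<integral>\<^sup>+z. ennreal (- c z) \<partial>\<sigma>)"
proof -
  note [measurable] = assms(1)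
  have "(\<integral>\<^sup>+z. ennreal (c z) \<partial>\<sigma>) + ennreal M * emeasure \<sigma> (space \<sigma>) =
      (\<integral>\<^sup>+z. ennreal (c z) + ennreal M \<partial>\<sigma>)"
    by (subst nn_integral_add) auto
  also have "\<dots> = (\<integral>\<^sup>+z. ennreal (c z + M) + ennreal (- c z) \<partial>\<sigma>)"
  proof (rule nn_integral_cong_AE, use assms(2) in eventually_elim)
    fix z assume "- M \<le> c z"
    then show "ennreal (c z) + ennreal M = ennreal (c z + M) + ennreal (- c z)"
      using assms(3) by (cases "0 \<le> c z") (auto simp: ennreal_neg simp flip: ennreal_plus)
  qed
  also have "\<dots> = (\<integral>\<^sup>+z. ennreal (c z + M) \<partial>\<sigma>) + (\<integral>\<^sup>+z. ennreal (- c z) \<partial>\<sigma>)"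
    by (subst nn_integral_add) auto
  finally show ?thesis .
qed

lemma signed_integral_neg_iff:
  assumes c: "c \<in> borel_measurable borel"
    and s: "sets \<sigma>p = sets borel" "sets \<sigma>n = sets borel"
    and fin: "finite_measure \<sigma>p" "finite_measure \<sigma>n"
    and mass: "emeasure \<sigma>p UNIV = emeasure \<sigma>n UNIV"
    and bd: "AE z in \<sigma>p. - M \<le> c z" "AE z in \<sigma>n. - M \<le> c z" and M: "0 \<le> M"
  shows "signed_integral_neg c \<sigma>p \<sigma>n \<longleftrightarrow>
         (\<integral>\<^sup>+z. ennreal (c z + M) \<partial>\<sigma>p) < (\<integral>\<^sup>+z. ennreal (c z + M) \<partial>\<sigma>n)"
proof -
  define Pp Np Ip Pn Nn In where "Pp = (\<integral>\<^sup>+z. ennreal (c z) \<partial>\<sigma>p)" and "Np = (\<integral>\<^sup>+z. ennreal (- c z) \<partial>\<sigma>p)"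
    and "Ip = (\<integral>\<^sup>+z. ennreal (c z + M) \<partial>\<sigma>p)" and "Pn = (\<integral>\<^sup>+z. ennreal (c z) \<partial>\<sigma>n)"
    and "Nn = (\<integral>\<^sup>+z. ennreal (- c z) \<partial>\<sigma>n)" and "In = (\<integral>\<^sup>+z. ennreal (c z + M) \<partial>\<sigma>n)"
  note defs = this
  define m where "m = ennreal M * emeasure \<sigma>p UNIV"
  have sp: "space \<sigma>p = UNIV" "space \<sigma>n = UNIV"
    using s sets_eq_imp_space_eq by (metis space_borel)+
  have neg: "(\<integral>\<^sup>+z. ennreal (- c z) \<partial>\<sigma>) < \<infinity>"
    if "sets \<sigma> = sets borel" "finite_measure \<sigma>" "AE z in \<sigma>. - M \<le> c z" for \<sigma>
  proof -
    have "(\<integral>\<^sup>+z. ennreal (- c z) \<partial>\<sigma>) \<le> (\<integral>\<^sup>+z. ennreal M \<partial>\<sigma>)"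
      by (intro nn_integral_mono_AE, use that(3) in eventually_elim) (simp add: ennreal_leI)
    also have "\<dots> < \<infinity>" using finite_measure.emeasure_finite[OF that(2)]
      by (auto simp: ennreal_mult_less_top less_top)
    finally show ?thesis .
  qed
  have fins: "Np \<noteq> \<infinity>" "Nn \<noteq> \<infinity>" using neg[OF s(1) fin(1) bd(1)] neg[OF s(2) fin(2) bd(2)]
    by (auto simp: defs)
  have "m \<noteq> \<infinity>" using finite_measure.emeasure_finite[OF fin(1), of UNIV]
    by (auto simp: m_def ennreal_mult_eq_top_iff)
  have p: "Pp + m = Ip + Np"
    using nn_integral_add_const_parts[of c \<sigma>p M] c bd(1) M s sp
    by (simp add: defs m_def measurable_cong_sets[OF s(1) refl])
  have n: "Pn + m = In + Nn"
    using nn_integral_add_const_parts[of c \<sigma>n M] c bd(2) M s sp mass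
    by (simp add: defs m_def measurable_cong_sets[OF s(2) refl])
  have "Pp + Nn < Np + Pn \<longleftrightarrow> m + (Pp + Nn) < m + (Np + Pn)"
    using \<open>m \<noteq> \<infinity>\<close> by (simp add: ennreal_add_left_cancel_less)
  also have "m + (Pp + Nn) = (Np + Nn) + Ip" using p by (metis add.assoc add.commute)
  also have "m + (Np + Pn) = (Np + Nn) + In" using n by (metis add.assoc add.commute)
  also have "(Np + Nn) + Ip < (Np + Nn) + In \<longleftrightarrow> Ip < In"
    using fins by (simp add: ennreal_add_left_cancel_less)
  finally show ?thesis by (simp add: signed_integral_neg_def defs)
qed

lemma measurable_exchange [measurable]:
  "(\<lambda>z. (fst (fst z), snd (snd z))) \<in> borel \<Otimes>\<^sub>M borel \<rightarrow>\<^sub>M (borel :: (real \<times> real) measure)"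
  "(\<lambda>z. (fst (snd z), snd (fst z))) \<in> borel \<Otimes>\<^sub>M borel \<rightarrow>\<^sub>M (borel :: (real \<times> real) measure)"
  by (intro borel_measurable_Pair measurable_compose[OF measurable_fst] measurable_compose[OF measurable_snd]
      borel_measurable_continuous_onI continuous_intros)+

text \<open>Two pieces \<open>A\<close> and \<open>B\<close> of a plan that are separated in both coordinates can be partly exchanged:
  pairs \<open>(p, q)\<close> distributed by the product of the two pieces swap their second coordinates.  The
  fraction \<open>b / (a + b)\<close> of the piece \<open>A\<close> and the fraction \<open>a / (a + b)\<close> of \<open>B\<close> take part, which is the same
  mass \<open>a b / (a + b)\<close> on either side.\<close>

lemma transport_plan_exchange:
  assumes tp: "transport_plan \<mu>0 \<mu>1 \<gamma>"
    and [measurable]: "A \<in> sets borel" "B \<in> sets borel" 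
      "A1 \<in> sets borel" "A2 \<in> sets borel" "B1 \<in> sets borel" "B2 \<in> sets borel"
    and sub: "A \<subseteq> A1 \<times> A2" "B \<subseteq> B1 \<times> B2" and dis: "A1 \<inter> B1 = {}" "A2 \<inter> B2 = {}"
    and box: "A \<subseteq> {-r..r} \<times> {-r..r}" "B \<subseteq> {-r..r} \<times> {-r..r}"
    and a: "emeasure \<gamma> A = ennreal a" "0 < a" and b: "emeasure \<gamma> B = ennreal b" "0 < b"
  defines "P \<equiv> density \<gamma> (indicator A) \<Otimes>\<^sub>M density \<gamma> (indicator B)"
  shows "emeasure P UNIV = ennreal (a * b)"
    and "AE (p, q) in P. p \<in> A \<and> q \<in> B"
    and "\<exists>\<gamma>' \<sigma>p \<sigma>n. transport_plan \<mu>0 \<mu>1 \<gamma>' \<and> compact_finite_diff \<gamma>' \<gamma> \<sigma>p \<sigma>n \<and>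
      (\<forall>f::real \<times> real \<Rightarrow> ennreal. f \<in> borel_measurable borel \<longrightarrow>
        (\<integral>\<^sup>+z. f z \<partial>\<sigma>p) = ennreal (1 / (a + b)) * (\<integral>\<^sup>+(p, q). f (fst p, snd q) + f (fst q, snd p) \<partial>P)) \<and>
      (\<forall>f::real \<times> real \<Rightarrow> ennreal. f \<in> borel_measurable borel \<longrightarrow>
        (\<integral>\<^sup>+z. f z \<partial>\<sigma>n) = ennreal (1 / (a + b)) * (\<integral>\<^sup>+(p, q). f p + f q \<partial>P))"
proof -
  note s [measurable_cong] = transport_planD(1)[OF tp]
  have sg: "space \<gamma> = UNIV" using transport_planD(2)[OF tp] .
  define RA RB where "RA = density \<gamma> (indicator A)" and "RB = density \<gamma> (indicator B)"
  have sR [measurable_cong]: "sets RA = sets borel" "sets RB = sets borel"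
    by (simp_all add: RA_def RB_def s)
  have spR: "space RA = UNIV" "space RB = UNIV" by (simp_all add: RA_def RB_def sg)
  have mRA: "emeasure RA UNIV = ennreal a" and mRB: "emeasure RB UNIV = ennreal b"
    unfolding RA_def RB_def using a(1) b(1)
    by (subst emeasure_density; (simp add: s)?; measurable?)+
  interpret RA: finite_measure RA by (rule finite_measureI) (simp add: spR mRA)
  interpret RB: finite_measure RB by (rule finite_measureI) (simp add: spR mRB)
  interpret RR: pair_sigma_finite RA RB ..
  have P: "P = RA \<Otimes>\<^sub>M RB" by (simp add: P_def RA_def RB_def)
  have spP: "space P = UNIV" by (simp add: P space_pair_measure spR)
  have sP [measurable_cong]: "sets P = sets (borel \<Otimes>\<^sub>M borel)"
    unfolding P by (intro sets_pair_measure_cong sR)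
  have "emeasure P (UNIV \<times> UNIV) = ennreal a * ennreal b"
    unfolding P by (subst RB.emeasure_pair_measure_Times) (auto simp: sR mRA mRB)
  then show massP: "emeasure P UNIV = ennreal (a * b)" 
    using a(2) by (simp add: ennreal_mult')
  have "AE p in RA. p \<in> A" unfolding RA_def by (subst AE_density) (auto simp: indicator_def)
  moreover have "AE q in RB. q \<in> B" unfolding RB_def by (subst AE_density) (auto simp: indicator_def)
  ultimately have "AE p in RA. AE q in RB. p \<in> A \<and> q \<in> B" by auto
  then show AEP: "AE (p, q) in P. p \<in> A \<and> q \<in> B"
    unfolding P
  proof (intro RR.AE_pair_measure)
    have "{z \<in> space (RA \<Otimes>\<^sub>M RB). case z of (p, q) \<Rightarrow> p \<in> A \<and> q \<in> B} = A \<times> B"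
      by (auto simp: space_pair_measure spR)
    then show "{z \<in> space (RA \<Otimes>\<^sub>M RB). case z of (p, q) \<Rightarrow> p \<in> A \<and> q \<in> B} \<in> sets (RA \<Otimes>\<^sub>M RB)"
      by (simp add: sR)
  qed auto
  define k where "k = ennreal (1 / (a + b))"
  define h where "h = (\<lambda>z. ennreal (b / (a + b)) * indicator A z + ennreal (a / (a + b)) * indicator B z)"
  define \<sigma>n where "\<sigma>n = density \<gamma> h"
  define \<sigma>p where "\<sigma>p = scale_measure k (add_measure (distr P borel (\<lambda>(p, q). (fst p, snd q)))
      (distr P borel (\<lambda>(p, q). (fst q, snd p))))"
  define \<gamma>' where "\<gamma>' = add_measure (density \<gamma> (\<lambda>z. 1 - h z)) \<sigma>p"
  have h[measurable]: "h \<in> borel_measurable borel" unfolding h_def by measurable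
  have AB: "A \<inter> B = {}" using sub dis by auto
  have h_le: "h z \<le> 1" for z
  proof -
    have "ennreal (b / (a + b)) \<le> 1" "ennreal (a / (a + b)) \<le> 1" using a(2) b(2) by (simp_all add: ennreal_le_1)
    then show ?thesis using AB by (auto simp: h_def indicator_def)
  qed
  have sn[measurable_cong]: "sets \<sigma>n = sets borel" by (simp add: \<sigma>n_def s)
  have sp[measurable_cong]: "sets \<sigma>p = sets borel" by (simp add: \<sigma>p_def)
  have int_p: "(\<integral>\<^sup>+z. f z \<partial>\<sigma>p) = k * (\<integral>\<^sup>+(p, q). f (fst p, snd q) + f (fst q, snd p) \<partial>P)"
    if [measurable]: "f \<in> borel_measurable borel" for f :: "real \<times> real \<Rightarrow> ennreal"
    unfolding \<sigma>p_def
    by (subst nn_integral_scale_measure)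
      (auto simp: nn_integral_add_measure nn_integral_distr split_beta' nn_integral_add
        intro!: arg_cong2[where f = "(*)"] nn_integral_add[symmetric])
  have kb: "k * ennreal b = ennreal (b / (a + b))" and ka: "k * ennreal a = ennreal (a / (a + b))"
    unfolding k_def using a(2) b(2) by (simp_all flip: ennreal_mult')
  have int_n: "(\<integral>\<^sup>+z. f z \<partial>\<sigma>n) = k * (\<integral>\<^sup>+(p, q). f p + f q \<partial>P)"
    if [measurable]: "f \<in> borel_measurable borel" for f :: "real \<times> real \<Rightarrow> ennreal"
  proof -
    have "(\<integral>\<^sup>+(p, q). f p + f q \<partial>P) = (\<integral>\<^sup>+(p, q). f p \<partial>P) + (\<integral>\<^sup>+(p, q). f q \<partial>P)"
      unfolding split_beta' by (rule nn_integral_add) measurable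
    also have "(\<integral>\<^sup>+(p, q). f p \<partial>P) = (\<integral>\<^sup>+p. f p \<partial>RA) * ennreal b"
    proof -
      have "(\<lambda>z. f (fst z)) \<in> borel_measurable (RA \<Otimes>\<^sub>M RB)" by measurable
      then show ?thesis
        using RB.nn_integral_fst[of "\<lambda>z. f (fst z)" RA]
        by (simp add: P split_beta' spR mRB nn_integral_multc)
    qed
    also have "(\<integral>\<^sup>+(p, q). f q \<partial>P) = (\<integral>\<^sup>+q. f q \<partial>RB) * ennreal a"
    proof -
      have "(\<lambda>z. f (snd z)) \<in> borel_measurable (RA \<Otimes>\<^sub>M RB)" by measurable
      then show ?thesis
        using RR.nn_integral_snd[of "\<lambda>z. f (snd z)"]
        by (simp add: P split_beta' spR mRA nn_integral_multc)
    qed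
    finally have "k * (\<integral>\<^sup>+(p, q). f p + f q \<partial>P) =
        ennreal (b / (a + b)) * (\<integral>\<^sup>+p. f p \<partial>RA) + ennreal (a / (a + b)) * (\<integral>\<^sup>+q. f q \<partial>RB)"
      by (simp add: distrib_left ac_simps flip: kb ka)
    also have "\<dots> = (\<integral>\<^sup>+z. h z * f z \<partial>\<gamma>)"
      unfolding RA_def RB_def h_def
      by (simp add: nn_integral_density nn_integral_add nn_integral_cmult distrib_right mult.assoc)
    also have "\<dots> = (\<integral>\<^sup>+z. f z \<partial>\<sigma>n)" unfolding \<sigma>n_def by (simp add: nn_integral_density)
    finally show ?thesis by simp
  qed
  have em_p: "emeasure \<sigma>p X = k * (\<integral>\<^sup>+(p, q). indicator X (fst p, snd q) + indicator X (fst q, snd p) \<partial>P)"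
    if [measurable]: "X \<in> sets borel" for X
    using int_p[of "indicator X"] by simp
  have em_n: "emeasure \<sigma>n X = k * (\<integral>\<^sup>+(p, q). indicator X p + indicator X q \<partial>P)"
    if [measurable]: "X \<in> sets borel" for X
    using int_n[of "indicator X"] by simp
  have rect: "X \<times> Y \<in> sets borel" if "X \<in> sets borel" "Y \<in> sets borel" for X Y :: "real set"
    using that by (rule borel_Times)
  have m0: "emeasure \<sigma>p (X \<times> UNIV) = emeasure \<sigma>n (X \<times> UNIV)"
      "emeasure \<sigma>p (UNIV \<times> X) = emeasure \<sigma>n (UNIV \<times> X)" if "X \<in> sets borel" for X
    using that by (simp_all add: em_p em_n rect indicator_times split_beta' add.commute)
  have "emeasure \<sigma>n UNIV = k * (\<integral>\<^sup>+(p, q). 2 \<partial>P)"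
    by (simp add: em_n)
  also have "\<dots> = k * (2 * ennreal (a * b))" by (simp add: split_beta' spP massP)
  also have "\<dots> < \<infinity>" by (simp add: k_def ennreal_mult_less_top)
  finally have "finite_measure \<sigma>n" 
    by (intro finite_measureI) (simp add: sets_eq_imp_space_eq[OF sn])
  moreover have "emeasure \<sigma>p UNIV = emeasure \<sigma>n UNIV" using m0(1)[of UNIV] by simp
  ultimately have "finite_measure \<sigma>p"
    using finite_measure.emeasure_finite[of \<sigma>n UNIV]
    by (intro finite_measureI) (simp add: sets_eq_imp_space_eq[OF sp])
  let ?S = "A1 \<times> B2 \<union> B1 \<times> A2" and ?K = "{-r..r} \<times> {-r..r}"
  have null: "k * (\<integral>\<^sup>+(p, q). g p q \<partial>P) = 0"
    if "\<And>p q. p \<in> A \<Longrightarrow> q \<in> B \<Longrightarrow> g p q = 0" for g :: "real \<times> real \<Rightarrow> real \<times> real \<Rightarrow> ennreal"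
  proof -
    have "(\<integral>\<^sup>+(p, q). g p q \<partial>P) = (\<integral>\<^sup>+z. 0 \<partial>P)"
    proof (rule nn_integral_cong_AE)
      show "AE z in P. (case z of (p, q) \<Rightarrow> g p q) = 0"
        by (rule AE_mp[OF AEP], rule AE_I2) (auto simp: that)
    qed
    then show ?thesis by simp
  qed
  have S: "?S \<in> sets borel" "- ?S \<in> sets borel" and K: "- ?K \<in> sets borel"
    by (auto intro!: rect borel_comp)
  \<comment> \<open>Removed and added mass sit on disjoint rectangles, which gives the Jordan decomposition.\<close>
  have S0: "emeasure \<sigma>p (- ?S) = 0" "emeasure \<sigma>n ?S = 0"
    unfolding em_p[OF S(2)] em_n[OF S(1)]
    by (rule null, use sub dis in \<open>force simp: indicator_def\<close>)+
  have K0: "emeasure \<sigma>p (- ?K) = 0" "emeasure \<sigma>n (- ?K) = 0"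
    unfolding em_p[OF K] em_n[OF K]
    by (rule null, use box in \<open>force simp: indicator_def\<close>)+
  have diff: "emeasure \<gamma>' X + emeasure \<sigma>n X = emeasure \<gamma> X + emeasure \<sigma>p X"
    if [measurable]: "X \<in> sets borel" for X
  proof -
    have "emeasure (density \<gamma> (\<lambda>z. 1 - h z)) X + emeasure \<sigma>n X =
        (\<integral>\<^sup>+z. (1 - h z) * indicator X z + h z * indicator X z \<partial>\<gamma>)"
      unfolding \<sigma>n_def by (simp add: emeasure_density nn_integral_add)
    also have "\<dots> = (\<integral>\<^sup>+z. indicator X z \<partial>\<gamma>)"
      using h_le by (intro nn_integral_cong) (auto simp: indicator_def diff_add_cancel_ennreal)
    finally have "emeasure (density \<gamma> (\<lambda>z. 1 - h z)) X + emeasure \<sigma>n X = emeasure \<gamma> X" by simp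
    then show ?thesis unfolding \<gamma>'_def
      by (subst emeasure_add_measure) (auto simp: s sp ac_simps)
  qed
  have cfd: "compact_finite_diff \<gamma>' \<gamma> \<sigma>p \<sigma>n"
    unfolding compact_finite_diff_def
  proof (intro conjI)
    show "\<exists>S\<in>sets borel. emeasure \<sigma>p (- S) = 0 \<and> emeasure \<sigma>n S = 0" using S(1) S0 by blast
    show "\<exists>K. compact K \<and> emeasure \<sigma>p (- K) = 0 \<and> emeasure \<sigma>n (- K) = 0"
      by (rule exI[of _ ?K]) (simp add: K0 compact_Times)
    show "\<forall>X\<in>sets borel. emeasure \<gamma>' X + emeasure \<sigma>n X = emeasure \<gamma> X + emeasure \<sigma>p X"
      using diff by blast
  qed fact+
  then have "transport_plan \<mu>0 \<mu>1 \<gamma>'"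
    by (intro transport_plan_modification[OF tp _ cfd] m0) (simp add: \<gamma>'_def)
  then show "\<exists>\<gamma>' \<sigma>p \<sigma>n. transport_plan \<mu>0 \<mu>1 \<gamma>' \<and> compact_finite_diff \<gamma>' \<gamma> \<sigma>p \<sigma>n \<and>
      (\<forall>f::real \<times> real \<Rightarrow> ennreal. f \<in> borel_measurable borel \<longrightarrow>
        (\<integral>\<^sup>+z. f z \<partial>\<sigma>p) = ennreal (1 / (a + b)) * (\<integral>\<^sup>+(p, q). f (fst p, snd q) + f (fst q, snd p) \<partial>P)) \<and>
      (\<forall>f::real \<times> real \<Rightarrow> ennreal. f \<in> borel_measurable borel \<longrightarrow>
        (\<integral>\<^sup>+z. f z \<partial>\<sigma>n) = ennreal (1 / (a + b)) * (\<integral>\<^sup>+(p, q). f p + f q \<partial>P))"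
    unfolding k_def[symmetric]
    using cfd by (intro exI[of _ \<gamma>'] exI[of _ \<sigma>p] exI[of _ \<sigma>n] conjI allI impI int_p int_n)
qed

text \<open>A locally optimal plan cannot charge two rectangles between which every exchange of partners lowers
  the cost.  The cost may be locally unbounded above, so only the parts of the rectangles that lie
  in a large square and on which the cost is at most \<open>N\<close> are exchanged.  There the old cost is bounded;
  the new cost is bounded above by the old one, and below by hypothesis.\<close>

lemma locally_optimal_separated:
  fixes c :: "real \<times> real \<Rightarrow> real"
  assumes lo: "locally_optimal \<mu>0 \<mu>1 c \<gamma>"
    and c [measurable]: "c \<in> borel_measurable borel"
    and bd: "\<And>r. \<exists>M. \<forall>x\<in>{-r..r}. \<forall>y\<in>{-r..r}. - M \<le> c (x, y)"
    and [measurable]: "A1 \<in> sets borel" "A2 \<in> sets borel" "B1 \<in> sets borel" "B2 \<in> sets borel"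
    and less: "\<And>x1 y1 x2 y2. x1 \<in> A1 \<Longrightarrow> y1 \<in> A2 \<Longrightarrow> x2 \<in> B1 \<Longrightarrow> y2 \<in> B2 \<Longrightarrow>
        c (x1, y2) + c (x2, y1) < c (x1, y1) + c (x2, y2)"
  shows "emeasure \<gamma> (A1 \<times> A2) = 0 \<or> emeasure \<gamma> (B1 \<times> B2) = 0"
proof (rule ccontr)
  assume "\<not> ?thesis"
  then have pos: "emeasure \<gamma> (A1 \<times> A2) \<noteq> 0" "emeasure \<gamma> (B1 \<times> B2) \<noteq> 0" by auto
  have tp: "transport_plan \<mu>0 \<mu>1 \<gamma>" using lo by (simp add: locally_optimal_def)
  note s [measurable_cong] = transport_planD(1)[OF tp]
  have rect [measurable]: "X \<times> Y \<in> sets borel" if "X \<in> sets borel" "Y \<in> sets borel" for X Y :: "real set"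
    using that by (rule borel_Times)
  define T where "T n = {-real n..real n} \<times> {-real n..real n} \<inter> {z. c z \<le> real n}" for n
  have T: "T n \<in> sets borel" for n
    unfolding T_def by (intro sets.Int rect) auto
  have T_mono: "T m \<subseteq> T n" if "m \<le> n" for m n
    using that by (force simp: T_def)
  have T_cover: "(\<Union>n. T n) = UNIV"
  proof -
    have "z \<in> (\<Union>n. T n)" for z
    proof -
      obtain n where "max (max \<bar>fst z\<bar> \<bar>snd z\<bar>) (c z) < real n" using reals_Archimedean2 by blast
      then have "z \<in> T n" by (auto simp: T_def mem_Times_iff)
      then show ?thesis by blast
    qed
    then show ?thesis by blast
  qed
  have ex: "\<exists>n. emeasure \<gamma> (X \<inter> T n) \<noteq> 0" if "X \<in> sets borel" "emeasure \<gamma> X \<noteq> 0" for X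
  proof (rule ccontr)
    assume "\<nexists>n. emeasure \<gamma> (X \<inter> T n) \<noteq> 0"
    then have "emeasure \<gamma> (\<Union>n. X \<inter> T n) = 0"
      using that T s by (intro emeasure_UN_eq_0) auto
    also have "(\<Union>n. X \<inter> T n) = X" using T_cover by blast
    finally show False using that by simp
  qed
  obtain n1 n2 where n: "emeasure \<gamma> (A1 \<times> A2 \<inter> T n1) \<noteq> 0" "emeasure \<gamma> (B1 \<times> B2 \<inter> T n2) \<noteq> 0"
    using ex[OF _ pos(1)] ex[OF _ pos(2)] by auto
  define N where "N = max n1 n2"
  define A B where "A = A1 \<times> A2 \<inter> T N" and "B = B1 \<times> B2 \<inter> T N"
  have AB [measurable]: "A \<in> sets borel" "B \<in> sets borel" using T by (auto simp: A_def B_def)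
  have "emeasure \<gamma> (A1 \<times> A2 \<inter> T n1) \<le> emeasure \<gamma> A" "emeasure \<gamma> (B1 \<times> B2 \<inter> T n2) \<le> emeasure \<gamma> B"
    using T_mono[of n1 N] T_mono[of n2 N] AB s
    by (auto intro!: emeasure_mono simp: A_def B_def N_def)
  then have pos': "emeasure \<gamma> A \<noteq> 0" "emeasure \<gamma> B \<noteq> 0" using n by auto
  have fin: "emeasure \<gamma> X < \<infinity>" if "X \<subseteq> T N" for X
  proof -
    have "emeasure \<gamma> X \<le> emeasure \<gamma> ({-real N..real N} \<times> UNIV)"
      using that s by (intro emeasure_mono) (auto simp: T_def)
    also have "\<dots> = emeasure \<mu>0 {-real N..real N}"
      using transport_planD(3)[OF tp] by auto
    also have "\<dots> < \<infinity>" using tp by (intro emeasure_Icc_finite) (simp add: transport_plan_def)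
    finally show ?thesis .
  qed
  have "\<exists>a>0. emeasure \<gamma> X = ennreal a" if "emeasure \<gamma> X \<noteq> 0" "emeasure \<gamma> X < \<infinity>" for X
    using that by (cases "emeasure \<gamma> X") (auto simp: less_le)
  then obtain a b where a: "emeasure \<gamma> A = ennreal a" "0 < a" and b: "emeasure \<gamma> B = ennreal b" "0 < b"
    using pos' fin[of A] fin[of B] by (metis A_def B_def Int_lower2)
  have sub: "A \<subseteq> A1 \<times> A2" "B \<subseteq> B1 \<times> B2" by (auto simp: A_def B_def)
  obtain x1 y1 x2 y2 where "(x1, y1) \<in> A" "(x2, y2) \<in> B"
    using pos' by (metis emeasure_empty equals0I surj_pair)
  then have ne: "x1 \<in> A1" "y1 \<in> A2" "x2 \<in> B1" "y2 \<in> B2" using sub by auto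
  have dis: "A1 \<inter> B1 = {}" "A2 \<inter> B2 = {}"
    using less[of _ y1 _ y2] less[of x1 _ x2] ne by (fastforce simp: add.commute)+
  have box: "A \<subseteq> {-real N..real N} \<times> {-real N..real N}" "B \<subseteq> {-real N..real N} \<times> {-real N..real N}"
    by (auto simp: A_def B_def T_def)
  define P where "P = density \<gamma> (indicator A) \<Otimes>\<^sub>M density \<gamma> (indicator B)"
  note ex = transport_plan_exchange[OF tp AB assms(4-7) sub dis box a b, folded P_def]
  obtain \<gamma>' \<sigma>p \<sigma>n where tp': "transport_plan \<mu>0 \<mu>1 \<gamma>'" and cfd: "compact_finite_diff \<gamma>' \<gamma> \<sigma>p \<sigma>n"
    and int_p: "\<And>f::real \<times> real \<Rightarrow> ennreal. f \<in> borel_measurable borel \<Longrightarrow>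
        (\<integral>\<^sup>+z. f z \<partial>\<sigma>p) = ennreal (1 / (a + b)) * (\<integral>\<^sup>+(p, q). f (fst p, snd q) + f (fst q, snd p) \<partial>P)"
    and int_n: "\<And>f::real \<times> real \<Rightarrow> ennreal. f \<in> borel_measurable borel \<Longrightarrow>
        (\<integral>\<^sup>+z. f z \<partial>\<sigma>n) = ennreal (1 / (a + b)) * (\<integral>\<^sup>+(p, q). f p + f q \<partial>P)"
    using ex(3) by blast
  have sP [measurable_cong]: "sets P = sets (borel \<Otimes>\<^sub>M borel)"
    unfolding P_def by (intro sets_pair_measure_cong) (simp_all add: s)
  have ss: "sets \<sigma>p = sets borel" "sets \<sigma>n = sets borel" "finite_measure \<sigma>p" "finite_measure \<sigma>n"
    using cfd by (auto simp: compact_finite_diff_def)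
  obtain K where K: "compact K" "emeasure \<sigma>p (- K) = 0" "emeasure \<sigma>n (- K) = 0"
    using cfd by (auto simp: compact_finite_diff_def)
  obtain r where r: "K \<subseteq> {-r..r} \<times> {-r..r}" using compact_subset_square[OF K(1)] by metis
  define R where "R = max r (real N)"
  obtain M0 where M0: "\<And>x y. x \<in> {-R..R} \<Longrightarrow> y \<in> {-R..R} \<Longrightarrow> - M0 \<le> c (x, y)"
    using bd[of R] by blast
  define M where "M = max M0 0"
  have M: "- M \<le> c z" if "z \<in> {-R..R} \<times> {-R..R}" for z
    using M0[of "fst z" "snd z"] that by (auto simp: M_def)
  have KR: "K \<subseteq> {-R..R} \<times> {-R..R}"
    using r by (rule order_trans) (auto simp: R_def)
  have "AE z in \<sigma>. - M \<le> c z" if "sets \<sigma> = sets borel" "emeasure \<sigma> (- K) = 0" for \<sigma>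
  proof (rule AE_I[of _ _ "- K"])
    show "{z \<in> space \<sigma>. \<not> - M \<le> c z} \<subseteq> - K"
      using M KR by blast
    show "- K \<in> sets \<sigma>" using K(1) that by (simp add: borel_comp borel_compact)
  qed (fact that)
  then have AEs: "AE z in \<sigma>p. - M \<le> c z" "AE z in \<sigma>n. - M \<le> c z" using ss K by blast+
  define g where "g = (\<lambda>z. ennreal (c z + M))"
  have g [measurable]: "g \<in> borel_measurable borel" by (simp add: g_def)
  have mass: "emeasure \<sigma>p UNIV = emeasure \<sigma>n UNIV"
    using int_p[of "\<lambda>_. 1"] int_n[of "\<lambda>_. 1"] sets_eq_imp_space_eq[OF ss(1)] sets_eq_imp_space_eq[OF ss(2)]
    by simp
  let ?new = "\<lambda>(p, q). g (fst p, snd q) + g (fst q, snd p)" and ?old = "\<lambda>(p, q). g p + g q"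
  have AEP: "AE (p, q) in P. p \<in> A \<and> q \<in> B" by (rule ex(2))
  have strict: "?new (p, q) < ?old (p, q)" and le: "?old (p, q) \<le> ennreal (2 * (real N + M))"
    if "p \<in> A" "q \<in> B" for p q
  proof -
    have in_sq: "fst p \<in> {-R..R}" "snd p \<in> {-R..R}" "fst q \<in> {-R..R}" "snd q \<in> {-R..R}"
      using that box by (force simp: R_def)+
    have nonneg: "0 \<le> c p + M" "0 \<le> c q + M" "0 \<le> c (fst p, snd q) + M" "0 \<le> c (fst q, snd p) + M"
      using M[of p] M[of q] M[of "(fst p, snd q)"] M[of "(fst q, snd p)"] in_sq
      by (auto simp: mem_Times_iff)
    have mem: "fst p \<in> A1" "snd p \<in> A2" "fst q \<in> B1" "snd q \<in> B2"
      using that sub by (auto simp: mem_Times_iff)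
    have "c (fst p, snd q) + c (fst q, snd p) < c p + c q"
      using less[OF mem] by simp
    then show "?new (p, q) < ?old (p, q)"
      using nonneg by (simp add: g_def ennreal_less_iff flip: ennreal_plus)
    have "c p \<le> real N" "c q \<le> real N" using that by (auto simp: A_def B_def T_def)
    then show "?old (p, q) \<le> ennreal (2 * (real N + M))"
      using nonneg by (simp add: g_def flip: ennreal_plus)
  qed
  have "(\<integral>\<^sup>+z. ?new z \<partial>P) < (\<integral>\<^sup>+z. ?old z \<partial>P)"
  proof (rule nn_integral_less)
    show "?new \<in> borel_measurable P"
      unfolding split_beta' fst_conv snd_conv
      by (intro borel_measurable_add measurable_compose[OF _ g]) measurable
    show "?old \<in> borel_measurable P" unfolding split_beta' by measurable
    have AE_le: "AE z in P. ?new z < ?old z \<and> ?old z \<le> ennreal (2 * (real N + M))"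
      by (rule AE_mp[OF AEP], rule AE_I2) (use strict le in auto)
    then show "AE z in P. ?new z \<le> ?old z" by eventually_elim auto
    have "(\<integral>\<^sup>+z. ?new z \<partial>P) \<le> (\<integral>\<^sup>+z. ennreal (2 * (real N + M)) \<partial>P)"
      by (rule nn_integral_mono_AE, use AE_le in eventually_elim) auto
    also have "\<dots> < \<infinity>" using ex(1) 
      by (simp add: P_def space_pair_measure transport_planD(2)[OF tp] ennreal_mult_less_top)
    finally show "(\<integral>\<^sup>+z. ?new z \<partial>P) \<noteq> \<infinity>" by simp
    show "\<not> (AE z in P. ?old z \<le> ?new z)"
    proof
      assume "AE z in P. ?old z \<le> ?new z"
      with AE_le have "AE z in P. False" by eventually_elim auto
      then have "emeasure P (space P) = 0" by (simp add: AE_iff_null null_sets_def)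
      moreover have "space P = UNIV" by (simp add: P_def space_pair_measure transport_planD(2)[OF tp])
      ultimately show False using ex(1) a(2) b(2) by simp
    qed
  qed
  then have "(\<integral>\<^sup>+z. g z \<partial>\<sigma>p) < (\<integral>\<^sup>+z. g z \<partial>\<sigma>n)"
    using int_p[OF g] int_n[OF g] a(2) b(2)
    by (simp add: ennreal_mult_strict_left_mono)
  then have "signed_integral_neg c \<sigma>p \<sigma>n"
    unfolding g_def
    by (subst signed_integral_neg_iff[OF c ss mass AEs]) (auto simp: M_def)
  then have "local_modification \<mu>0 \<mu>1 \<gamma> \<gamma>' \<and> cost_reducing c \<gamma> \<gamma>'"
    using tp tp' cfd by (auto simp: local_modification_def cost_reducing_def)
  then show False using lo by (auto simp: locally_optimal_def)
qed

section \<open>Distribution functions of measures with unit mass in each period\<close>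

text \<open>A Borel measure on the line that gives mass one to every half-open unit interval.\<close>

locale unit_mass_measure =
  fixes \<mu> :: "real measure"
  assumes sets_borel: "sets \<mu> = sets borel"
    and unit: "emeasure \<mu> {x<..x+1} = 1"
begin

lemma emeasure_periods: "emeasure \<mu> {a<..a + real n} = ennreal (real n)"
proof (induction n)
  case (Suc n)
  have "{a<..a + real (Suc n)} = {a<..a + real n} \<union> {a + real n<..(a + real n) + 1}" by auto
  then have "emeasure \<mu> {a<..a + real (Suc n)} = ennreal (real n) + 1"
    using Suc unit sets_borel by (simp add: plus_emeasure[symmetric])
  then show ?case by (simp add: add.commute)
qed simp

lemma emeasure_Ioc_finite: "emeasure \<mu> {a<..b} < \<infinity>"
proof -
  obtain n where "b - a < real n" using reals_Archimedean2 by blast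
  then have "emeasure \<mu> {a<..b} \<le> emeasure \<mu> {a<..a + real n}"
    using sets_borel by (intro emeasure_mono) auto
  then show ?thesis by (simp add: emeasure_periods le_less_trans)
qed

lemma locally_finite: "locally_finite_measure \<mu>"
  unfolding locally_finite_measure_def
proof (intro conjI allI)
  fix x :: real
  have "emeasure \<mu> {x - 1<..<x + 1} \<le> emeasure \<mu> {x - 1<..x + 1}"
    using sets_borel by (intro emeasure_mono) auto
  also have "\<dots> < \<infinity>" by (rule emeasure_Ioc_finite)
  finally show "\<exists>U. open U \<and> x \<in> U \<and> emeasure \<mu> U < \<infinity>"
    by (intro exI[of _ "{x - 1<..<x + 1}"]) auto
qed (fact sets_borel)

lemma dist_fun_diff:
  assumes "a \<le> b"
  shows "dist_fun \<mu> b - dist_fun \<mu> a = measure \<mu> {a<..b}"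
proof -
  have split: "measure \<mu> {x<..z} = measure \<mu> {x<..y} + measure \<mu> {y<..z}" if "x \<le> y" "y \<le> z" for x y z
  proof -
    have "{x<..z} = {x<..y} \<union> {y<..z}" using that by auto
    then show ?thesis
      using measure_Union[of \<mu> "{x<..y}" "{y<..z}"] emeasure_Ioc_finite[of x y] emeasure_Ioc_finite[of y z]
      by (simp add: sets_borel less_top)
  qed
  have pos: "dist_fun \<mu> x = measure \<mu> {0<..x}" if "0 \<le> x" for x using that by (simp add: dist_fun_def)
  have neg: "dist_fun \<mu> x = - measure \<mu> {x<..0}" if "x \<le> 0" for x using that by (simp add: dist_fun_def)
  consider "b \<le> 0" | "a \<le> 0" "0 \<le> b" | "0 \<le> a" by linarith
  then show ?thesis
  proof cases
    case 1
    then show ?thesis using assms split[of a b 0] neg[of a] neg[of b] by linarith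
  next
    case 2
    then show ?thesis using split[of a 0 b] neg[of a] pos[of b] by linarith
  next
    case 3
    then show ?thesis using assms split[of 0 a b] pos[of a] pos[of b] by linarith
  qed
qed

lemma emeasure_Ioc: "a \<le> b \<Longrightarrow> emeasure \<mu> {a<..b} = ennreal (dist_fun \<mu> b - dist_fun \<mu> a)"
  using emeasure_Ioc_finite[of a b]
  by (simp add: dist_fun_diff emeasure_eq_ennreal_measure less_top)

lemma dist_fun_mono: "a \<le> b \<Longrightarrow> dist_fun \<mu> a \<le> dist_fun \<mu> b"
  using dist_fun_diff[of a b] measure_nonneg[of \<mu> "{a<..b}"] by linarith

lemma dist_fun_of_int: "dist_fun \<mu> (of_int k) = of_int k"
proof (cases "0 \<le> k")
  case True
  then show ?thesis using emeasure_periods[of 0 "nat k"]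
    by (simp add: dist_fun_def measure_def)
next
  case False
  then have "{of_int k<..of_int k + real (nat (- k))} = {real_of_int k<..0}" by auto
  then show ?thesis using emeasure_periods[of "of_int k" "nat (- k)"] False
    by (simp add: dist_fun_def measure_def)
qed

lemma dist_fun_bounds: "x - 1 \<le> dist_fun \<mu> x" "dist_fun \<mu> x \<le> x + 1"
proof -
  have "of_int \<lfloor>x\<rfloor> \<le> dist_fun \<mu> x" "dist_fun \<mu> x \<le> of_int (\<lfloor>x\<rfloor> + 1)"
    using dist_fun_mono[of "of_int \<lfloor>x\<rfloor>" x] dist_fun_mono[of x "of_int (\<lfloor>x\<rfloor> + 1)"]
    unfolding dist_fun_of_int by linarith+
  then show "x - 1 \<le> dist_fun \<mu> x" "dist_fun \<mu> x \<le> x + 1" by linarith+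
qed

lemma dist_fun_right_continuous:
  assumes "\<And>y. x < y \<Longrightarrow> v \<le> dist_fun \<mu> y"
  shows "v \<le> dist_fun \<mu> x"
proof -
  let ?A = "\<lambda>n. {x<..x + inverse (real (Suc n))}"
  have "decseq ?A"
    by (auto simp: decseq_def intro!: le_imp_inverse_le elim!: order_trans)
  then have "(\<lambda>n. measure \<mu> (?A n)) \<longlonglongrightarrow> measure \<mu> (\<Inter>n. ?A n)"
    using emeasure_Ioc_finite sets_borel by (intro Lim_measure_decseq) (auto simp: less_top)
  moreover have "(\<Inter>n. ?A n) = {}"
  proof -
    have "y \<notin> (\<Inter>n. ?A n)" for y
    proof (cases "x < y")
      case True
      then obtain n where "inverse (real (Suc n)) < y - x" using reals_Archimedean[of "y - x"] by auto
      then have "y \<notin> ?A n" by auto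
      then show ?thesis by blast
    qed auto
    then show ?thesis by blast
  qed
  ultimately have "(\<lambda>n. measure \<mu> (?A n)) \<longlonglongrightarrow> 0" by simp
  moreover have "v - dist_fun \<mu> x \<le> measure \<mu> (?A n)" for n
    using assms[of "x + inverse (real (Suc n))"] dist_fun_diff[of x "x + inverse (real (Suc n))"] by simp
  ultimately have "v - dist_fun \<mu> x \<le> 0" by (intro LIMSEQ_le_const) auto
  then show ?thesis by simp
qed

text \<open>The condition \<open>dist_fun_inv \<mu> v \<le> x\<close> lies between \<open>v < dist_fun \<mu> x\<close> and \<open>v \<le> dist_fun \<mu> x\<close>; the next
  lemmas spell this out in the various directions in which it is used.\<close>

lemma dist_fun_inv_le: "v < dist_fun \<mu> x \<Longrightarrow> dist_fun_inv \<mu> v \<le> x"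
  unfolding dist_fun_inv_def
proof (rule cInf_lower)
  show "bdd_below {x. v < dist_fun \<mu> x}"
  proof (rule bdd_belowI)
    fix y assume "y \<in> {x. v < dist_fun \<mu> x}"
    then show "v - 1 \<le> y" using dist_fun_bounds(2)[of y] by auto
  qed
qed simp

lemma less_dist_fun:
  assumes "dist_fun_inv \<mu> v < x"
  shows "v < dist_fun \<mu> x"
proof -
  have "{x. v < dist_fun \<mu> x} \<noteq> {}"
    using dist_fun_bounds(1)[of "v + 2"] by (auto intro!: exI[of _ "v + 2"])
  from cInf_lessD[OF this assms[unfolded dist_fun_inv_def]]
  obtain y where "v < dist_fun \<mu> y" "y < x" by blast
  then show ?thesis using dist_fun_mono[of y x] by linarith
qed

lemma le_dist_fun: "dist_fun_inv \<mu> v \<le> x \<Longrightarrow> v \<le> dist_fun \<mu> x"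
  by (rule dist_fun_right_continuous) (meson le_less_trans less_dist_fun less_imp_le)

lemma dist_fun_le: "x < dist_fun_inv \<mu> v \<Longrightarrow> dist_fun \<mu> x \<le> v"
  using dist_fun_inv_le[of v x] by force

lemma dist_fun_inv_greater: "dist_fun \<mu> x < v \<Longrightarrow> x < dist_fun_inv \<mu> v"
  using le_dist_fun[of v x] by force

lemma dist_fun_inv_mono: "v \<le> w \<Longrightarrow> dist_fun_inv \<mu> v \<le> dist_fun_inv \<mu> w"
  by (rule dense_ge) (rule dist_fun_inv_le, drule less_dist_fun, simp)

lemma measurable_dist_fun_inv [measurable]: "dist_fun_inv \<mu> \<in> borel_measurable borel"
  by (rule borel_measurable_mono) (simp add: mono_def dist_fun_inv_mono)

lemma vimage_dist_fun_inv_borel: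
  "A \<in> sets borel \<Longrightarrow> dist_fun_inv \<mu> -` A \<in> sets borel"
  using measurable_sets[OF measurable_dist_fun_inv, of A] by simp

end

lemma emeasure_lborel_between:
  fixes l u :: real
  assumes "X \<in> sets borel" "{l<..<u} \<subseteq> X" "X \<subseteq> {l..u}"
  shows "emeasure lborel X = ennreal (u - l)"
proof (cases "l \<le> u")
  case True
  then show ?thesis
    using emeasure_mono[OF assms(2), of lborel] emeasure_mono[OF assms(3), of lborel] assms(1) by simp
next
  case False
  then have "X = {}" using assms(3) by auto
  then show ?thesis using False by (simp add: ennreal_neg)
qed

context unit_mass_measure
begin

lemma emeasure_lborel_vimage_dist_fun_inv:
  assumes "A \<in> sets borel"
  shows "emeasure lborel (dist_fun_inv \<mu> -` A) = emeasure \<mu> A"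
proof -
  have "distr lborel borel (dist_fun_inv \<mu>) = \<mu>"
  proof (rule measure_eq_of_Ioc)
    show eq: "emeasure (distr lborel borel (dist_fun_inv \<mu>)) {a<..b} = emeasure \<mu> {a<..b}" for a b
    proof (cases "a \<le> b")
      case True
      have "emeasure lborel (dist_fun_inv \<mu> -` {a<..b}) = ennreal (dist_fun \<mu> b - dist_fun \<mu> a)"
        by (rule emeasure_lborel_between)
          (auto intro: vimage_dist_fun_inv_borel dist_fun_inv_greater dist_fun_inv_le dist_fun_le le_dist_fun)
      then show ?thesis using True by (simp add: emeasure_distr emeasure_Ioc)
    qed simp
    show "emeasure (distr lborel borel (dist_fun_inv \<mu>)) {a<..b} < \<infinity>" for a b
      unfolding eq by (rule emeasure_Ioc_finite)
  qed (simp_all add: sets_borel)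
  then have "emeasure \<mu> A = emeasure (distr lborel borel (dist_fun_inv \<mu>)) A" by simp
  then show ?thesis using assms by (simp add: emeasure_distr)
qed

lemma dist_fun_left_limit:
  shows "y < x \<Longrightarrow> dist_fun \<mu> y \<le> Lim (at_left x) (dist_fun \<mu>)"
    and "(\<And>y. y < x \<Longrightarrow> dist_fun \<mu> y \<le> v) \<Longrightarrow> Lim (at_left x) (dist_fun \<mu>) \<le> v"
proof -
  let ?l = "Sup (dist_fun \<mu> ` {..<x})"
  have bdd: "bdd_above (dist_fun \<mu> ` {..<x})"
    using dist_fun_mono[of _ x] by (intro bdd_aboveI[of _ "dist_fun \<mu> x"]) auto
  have up: "dist_fun \<mu> y \<le> ?l" if "y < x" for y
    using that by (intro cSup_upper[OF _ bdd]) auto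
  have "(dist_fun \<mu> \<longlongrightarrow> ?l) (at_left x)"
  proof (rule increasing_tendsto)
    show "\<forall>\<^sub>F y in at_left x. dist_fun \<mu> y \<le> ?l"
      using up by (intro eventually_at_leftI[of "x - 1"]) auto
    fix u assume "u < ?l"
    then obtain y where y: "y < x" "u < dist_fun \<mu> y"
      using less_cSup_iff[OF _ bdd, of u] by auto
    show "\<forall>\<^sub>F z in at_left x. u < dist_fun \<mu> z"
      using y dist_fun_mono[of y] by (intro eventually_at_leftI[of y]) (auto intro: less_le_trans)
  qed
  then have lim: "Lim (at_left x) (dist_fun \<mu>) = ?l"
    by (intro tendsto_Lim) simp_all
  show "y < x \<Longrightarrow> dist_fun \<mu> y \<le> Lim (at_left x) (dist_fun \<mu>)" using up by (simp add: lim)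
  show "(\<And>y. y < x \<Longrightarrow> dist_fun \<mu> y \<le> v) \<Longrightarrow> Lim (at_left x) (dist_fun \<mu>) \<le> v"
    unfolding lim by (rule cSup_least) (auto intro: gt_ex lt_ex)
qed

text \<open>The set-valued image agrees with the preimage under the inverse up to the values that the
  distribution function takes on an interval of constancy.  Each such interval contains a rational,
  so these values are countably many.\<close>

lemma vimage_dist_fun_inv_subset_image: "dist_fun_inv \<mu> -` A \<subseteq> dist_fun_image \<mu> A"
proof
  fix v assume "v \<in> dist_fun_inv \<mu> -` A"
  moreover have "Lim (at_left (dist_fun_inv \<mu> v)) (dist_fun \<mu>) \<le> v"
    by (rule dist_fun_left_limit(2)) (rule dist_fun_le)
  ultimately show "v \<in> dist_fun_image \<mu> A"
    unfolding dist_fun_image_def using le_dist_fun[of v "dist_fun_inv \<mu> v"]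
    by (intro UN_I[of "dist_fun_inv \<mu> v"]) auto
qed

lemma dist_fun_image_subset: "dist_fun_image \<mu> A \<subseteq> dist_fun_inv \<mu> -` A \<union> dist_fun \<mu> ` \<rat>"
proof
  fix v assume "v \<in> dist_fun_image \<mu> A"
  then obtain x where x: "x \<in> A" "Lim (at_left x) (dist_fun \<mu>) \<le> v" "v \<le> dist_fun \<mu> x"
    by (auto simp: dist_fun_image_def)
  consider "x = dist_fun_inv \<mu> v" | "x < dist_fun_inv \<mu> v" | "dist_fun_inv \<mu> v < x" by linarith
  then show "v \<in> dist_fun_inv \<mu> -` A \<union> dist_fun \<mu> ` \<rat>"
  proof cases
    case 2
    then obtain q where q: "q \<in> \<rat>" "x < q" "q < dist_fun_inv \<mu> v" using Rats_dense_in_real by blast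
    then have "dist_fun \<mu> q = v"
      using dist_fun_le[of q v] dist_fun_mono[of x q] x(3) by linarith
    then show ?thesis using q(1) by blast
  next
    case 3
    then obtain q where q: "dist_fun_inv \<mu> v < q" "q < x" using dense by blast
    then show ?thesis using less_dist_fun[of v q] dist_fun_left_limit(1)[of q x] x(2) by linarith
  qed (use x(1) in simp)
qed

lemma dist_fun_image_differs:
  "countable (dist_fun_image \<mu> A - dist_fun_inv \<mu> -` A)"
  by (rule countable_subset[of _ "dist_fun \<mu> ` \<rat>"])
    (use dist_fun_image_subset[of A] countable_rat in auto)

end

section \<open>Conjugate plans as push-forwards\<close>

text \<open>The push-forward of a plan under the two inverse distribution functions.  It takes the place of the
  set-valued images in the definition of the conjugate plan: for a normal plan both agree on Borel
  rectangles, because the images differ from preimages by countable sets only.\<close>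

definition conj_measure :: "real measure \<Rightarrow> real measure \<Rightarrow> (real \<times> real) measure \<Rightarrow> (real \<times> real) measure" where
  "conj_measure \<mu>0 \<mu>1 \<nu> = distr \<nu> borel (\<lambda>z. (dist_fun_inv \<mu>0 (fst z), dist_fun_inv \<mu>1 (snd z)))"

lemma measurable_fst_borel [measurable]: "fst \<in> borel_measurable (borel :: (real \<times> real) measure)"
  and measurable_snd_borel [measurable]: "snd \<in> borel_measurable (borel :: (real \<times> real) measure)"
  by (intro borel_measurable_continuous_onI continuous_intros)+

text \<open>A pair of such measures, as marginals of a plan.\<close>

locale two_unit_mass_measures = M0: unit_mass_measure \<mu>0 + M1: unit_mass_measure \<mu>1
  for \<mu>0 \<mu>1
begin

lemma emeasure_conj_measure:
  assumes "normal_plan \<nu>" "A \<in> sets borel" "B \<in> sets borel"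
  shows "emeasure (conj_measure \<mu>0 \<mu>1 \<nu>) (A \<times> B) =
         emeasure \<nu> (dist_fun_inv \<mu>0 -` A \<times> dist_fun_inv \<mu>1 -` B)"
proof -
  note [measurable_cong] = transport_planD(1)[OF assms(1)[unfolded normal_plan_def]]
  have sp: "space \<nu> = UNIV" by (rule transport_planD(2)[OF assms(1)[unfolded normal_plan_def]])
  have "(\<lambda>z. dist_fun_inv \<mu>0 (fst z)) \<in> borel_measurable \<nu>" "(\<lambda>z. dist_fun_inv \<mu>1 (snd z)) \<in> borel_measurable \<nu>"
    by measurable
  then have "(\<lambda>z. (dist_fun_inv \<mu>0 (fst z), dist_fun_inv \<mu>1 (snd z))) \<in> borel_measurable \<nu>"
    by (rule borel_measurable_Pair)
  then show ?thesis unfolding conj_measure_def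
    using assms by (subst emeasure_distr) (auto simp: sp borel_Times intro!: arg_cong[where f = "emeasure \<nu>"])
qed

lemma transport_plan_conj_measure:
  assumes \<nu>: "normal_plan \<nu>"
  shows "transport_plan \<mu>0 \<mu>1 (conj_measure \<mu>0 \<mu>1 \<nu>)"
  unfolding transport_plan_iff
proof (intro conjI allI ballI)
  note tp = \<nu>[unfolded normal_plan_def]
  let ?G0 = "dist_fun_inv \<mu>0" and ?G1 = "dist_fun_inv \<mu>1"
  show "locally_finite_measure \<mu>0" "locally_finite_measure \<mu>1"
    by (rule M0.locally_finite M1.locally_finite)+
  show "sets (conj_measure \<mu>0 \<mu>1 \<nu>) = sets borel" by (simp add: conj_measure_def)
  note em = emeasure_conj_measure[OF \<nu>]
  show "emeasure (conj_measure \<mu>0 \<mu>1 \<nu>) (A \<times> UNIV) = emeasure \<mu>0 A" if "A \<in> sets borel" for A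
    using that transport_planD(3)[OF tp, of "?G0 -` A"]
    by (simp add: em M0.vimage_dist_fun_inv_borel M0.emeasure_lborel_vimage_dist_fun_inv)
  show "emeasure (conj_measure \<mu>0 \<mu>1 \<nu>) (UNIV \<times> A) = emeasure \<mu>1 A" if "A \<in> sets borel" for A
    using that transport_planD(4)[OF tp, of "?G1 -` A"]
    by (simp add: em M1.vimage_dist_fun_inv_borel M1.emeasure_lborel_vimage_dist_fun_inv)
  have zero: "emeasure (conj_measure \<mu>0 \<mu>1 \<nu>) (A \<times> B) = 0"
    if "A \<in> sets borel" "B \<in> sets borel" "emeasure \<nu> (C \<times> D) = 0" "C \<in> sets borel" "D \<in> sets borel"
      "?G0 -` A \<subseteq> C" "?G1 -` B \<subseteq> D" for A B C D
  proof -
    have "emeasure \<nu> (?G0 -` A \<times> ?G1 -` B) \<le> emeasure \<nu> (C \<times> D)"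
      using that transport_planD(1)[OF tp] by (intro emeasure_mono) (auto simp: borel_Times)
    then show ?thesis using that by (simp add: em)
  qed
  fix x
  have tpD: "\<exists>y. emeasure \<nu> ({..z} \<times> {y<..}) = 0" "\<exists>y. emeasure \<nu> ({y<..} \<times> {..z}) = 0"
    "\<exists>y. emeasure \<nu> ({z<..} \<times> {..<y}) = 0" "\<exists>y. emeasure \<nu> ({..<y} \<times> {z<..}) = 0" for z
    using tp unfolding transport_plan_iff by blast+
  obtain y where "emeasure \<nu> ({..dist_fun \<mu>0 x} \<times> {y<..}) = 0" using tpD(1) by blast
  then show "\<exists>y. emeasure (conj_measure \<mu>0 \<mu>1 \<nu>) ({..x} \<times> {y<..}) = 0"
    using M1.dist_fun_bounds(1)[of "y + 2"]
    by (intro exI[of _ "y + 2"] zero[where C = "{..dist_fun \<mu>0 x}" and D = "{y<..}"])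
      (auto dest: M0.le_dist_fun M1.dist_fun_le)
  obtain y where "emeasure \<nu> ({y<..} \<times> {..dist_fun \<mu>1 x}) = 0" using tpD(2) by blast
  then show "\<exists>y. emeasure (conj_measure \<mu>0 \<mu>1 \<nu>) ({y<..} \<times> {..x}) = 0"
    using M0.dist_fun_bounds(1)[of "y + 2"]
    by (intro exI[of _ "y + 2"] zero[where C = "{y<..}" and D = "{..dist_fun \<mu>1 x}"])
      (auto dest: M1.le_dist_fun M0.dist_fun_le)
  obtain y where "emeasure \<nu> ({dist_fun \<mu>0 x - 1<..} \<times> {..<y}) = 0" using tpD(3) by blast
  then show "\<exists>y. emeasure (conj_measure \<mu>0 \<mu>1 \<nu>) ({x<..} \<times> {..<y}) = 0"
    using M1.dist_fun_bounds(2)[of "y - 2"]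
    by (intro exI[of _ "y - 2"] zero[where C = "{dist_fun \<mu>0 x - 1<..}" and D = "{..<y}"])
      (auto dest!: M0.dist_fun_le M1.less_dist_fun)
  obtain y where "emeasure \<nu> ({..<y} \<times> {dist_fun \<mu>1 x - 1<..}) = 0" using tpD(4) by blast
  then show "\<exists>y. emeasure (conj_measure \<mu>0 \<mu>1 \<nu>) ({..<y} \<times> {x<..}) = 0"
    using M0.dist_fun_bounds(2)[of "y - 2"]
    by (intro exI[of _ "y - 2"] zero[where C = "{..<y}" and D = "{dist_fun \<mu>1 x - 1<..}"])
      (auto dest!: M1.dist_fun_le M0.less_dist_fun)
qed

lemma conjugate_plan_iff:
  assumes \<nu>: "normal_plan \<nu>"
  shows "conjugate_plan \<mu>0 \<mu>1 \<nu> \<gamma> \<longleftrightarrow> transport_plan \<mu>0 \<mu>1 \<gamma> \<and>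
     (\<forall>A\<in>sets borel. \<forall>B\<in>sets borel. emeasure \<gamma> (A \<times> B) = emeasure (conj_measure \<mu>0 \<mu>1 \<nu>) (A \<times> B))"
proof -
  note tp = \<nu>[unfolded normal_plan_def]
  have "emeasure \<nu> (dist_fun_image \<mu>0 A \<times> dist_fun_image \<mu>1 B) = emeasure (conj_measure \<mu>0 \<mu>1 \<nu>) (A \<times> B)"
    if [measurable]: "A \<in> sets borel" "B \<in> sets borel" for A B
  proof -
    let ?X = "dist_fun_inv \<mu>0 -` A" and ?Y = "dist_fun_inv \<mu>1 -` B"
    define C D where "C = dist_fun_image \<mu>0 A - ?X" and "D = dist_fun_image \<mu>1 B - ?Y"
    have XY: "?X \<in> sets borel" "?Y \<in> sets borel"
      by (simp_all add: M0.vimage_dist_fun_inv_borel M1.vimage_dist_fun_inv_borel)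
    have CD: "countable C" "countable D"
      unfolding C_def D_def by (rule M0.dist_fun_image_differs M1.dist_fun_image_differs)+
    then have CDb: "C \<in> sets borel" "D \<in> sets borel"
      using sets.countable[of _ "borel :: real measure"] CD by (metis borel_singleton sets.empty_sets)+
    have im: "dist_fun_image \<mu>0 A = ?X \<union> C" "dist_fun_image \<mu>1 B = ?Y \<union> D"
      using M0.vimage_dist_fun_inv_subset_image[of A] M1.vimage_dist_fun_inv_subset_image[of B]
      by (auto simp: C_def D_def)
    have null: "C \<times> UNIV \<union> UNIV \<times> D \<in> null_sets \<nu>"
    proof (rule null_sets.Un)
      show "C \<times> UNIV \<in> null_sets \<nu>"
        using transport_planD(1,3)[OF tp] CDb(1) emeasure_lborel_countable[OF CD(1)]
        by (intro null_setsI) (simp_all add: borel_Times)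
      show "UNIV \<times> D \<in> null_sets \<nu>"
        using transport_planD(1,4)[OF tp] CDb(2) emeasure_lborel_countable[OF CD(2)]
        by (intro null_setsI) (simp_all add: borel_Times)
    qed
    have "emeasure \<nu> (dist_fun_image \<mu>0 A \<times> dist_fun_image \<mu>1 B) = emeasure \<nu> (?X \<times> ?Y)"
    proof (rule emeasure_eq_AE)
      have "AE z in \<nu>. z \<notin> C \<times> UNIV \<union> UNIV \<times> D" using null by (rule AE_not_in)
      then show "AE z in \<nu>. (z \<in> dist_fun_image \<mu>0 A \<times> dist_fun_image \<mu>1 B) = (z \<in> ?X \<times> ?Y)"
        by eventually_elim (unfold im, blast)
      show "dist_fun_image \<mu>0 A \<times> dist_fun_image \<mu>1 B \<in> sets \<nu>"
        unfolding im transport_planD(1)[OF tp] by (intro borel_Times sets.Un XY CDb)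
      show "?X \<times> ?Y \<in> sets \<nu>" unfolding transport_planD(1)[OF tp] by (intro borel_Times XY)
    qed
    then show ?thesis using that by (simp add: emeasure_conj_measure[OF \<nu>])
  qed
  then show ?thesis by (auto simp: conjugate_plan_def)
qed

end

section \<open>The shift plans\<close>

text \<open>The measure on the line \<open>w = v + \<theta>\<close> that projects to Lebesgue measure on either axis.\<close>

definition shift_measure :: "real \<Rightarrow> (real \<times> real) measure" where
  "shift_measure \<theta> = distr lborel borel (\<lambda>v. (v, v + \<theta>))"

lemma emeasure_shift_measure:
  assumes "X \<in> sets borel"
  shows "emeasure (shift_measure \<theta>) X = emeasure lborel {v. (v, v + \<theta>) \<in> X}"
  unfolding shift_measure_def using assms
  by (subst emeasure_distr) (auto intro!: borel_measurable_Pair arg_cong[where f = "emeasure lborel"])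

lemma normal_plan_shift_measure: "normal_plan (shift_measure \<theta>)"
  unfolding normal_plan_def transport_plan_iff
proof (intro conjI allI ballI)
  have "\<exists>U. open U \<and> x \<in> U \<and> emeasure lborel U < \<infinity>" for x :: real
    by (rule exI[of _ "{x - 1<..<x + 1}"]) auto
  then show "locally_finite_measure (lborel :: real measure)" "locally_finite_measure (lborel :: real measure)"
    by (simp_all add: locally_finite_measure_def)
  show "sets (shift_measure \<theta>) = sets borel" by (simp add: shift_measure_def)
  note em = emeasure_shift_measure[OF borel_Times]
  have zero: "emeasure (shift_measure \<theta>) (A \<times> B) = 0"
    if "A \<in> sets borel" "B \<in> sets borel" "\<And>v. v \<in> A \<Longrightarrow> v + \<theta> \<notin> B" for A B
  proof -
    have "{v. (v, v + \<theta>) \<in> A \<times> B} = {}" using that(3) by auto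
    then show ?thesis unfolding em[OF that(1,2)] by (simp only: emeasure_empty)
  qed
  show "\<exists>y. emeasure (shift_measure \<theta>) ({..x} \<times> {y<..}) = 0" for x
    by (rule exI[of _ "x + \<theta>"], rule zero) auto
  show "\<exists>y. emeasure (shift_measure \<theta>) ({y<..} \<times> {..x}) = 0" for x
    by (rule exI[of _ "x - \<theta>"], rule zero) auto
  show "\<exists>y. emeasure (shift_measure \<theta>) ({x<..} \<times> {..<y}) = 0" for x
    by (rule exI[of _ "x + \<theta>"], rule zero) auto
  show "\<exists>y. emeasure (shift_measure \<theta>) ({..<y} \<times> {x<..}) = 0" for x
    by (rule exI[of _ "x - \<theta>"], rule zero) auto
  fix A :: "real set"
  assume A: "A \<in> sets borel"
  show "emeasure (shift_measure \<theta>) (A \<times> UNIV) = emeasure lborel A"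
    using A by (simp add: em)
  have "emeasure lborel A = emeasure (distr lborel borel ((+) \<theta>)) A"
    by (simp add: lborel_distr_plus)
  also have "\<dots> = emeasure lborel {v. v + \<theta> \<in> A}"
    using A by (subst emeasure_distr) (auto simp: add.commute intro!: arg_cong[where f = "emeasure lborel"])
  finally show "emeasure (shift_measure \<theta>) (UNIV \<times> A) = emeasure lborel A"
    using A by (simp add: em)
qed

lemma shift_plan_shift_measure: "shift_plan \<theta> (shift_measure \<theta>)"
  unfolding shift_plan_def
proof (intro conjI set_eqI iffI)
  fix z assume z: "z \<in> measure_support (shift_measure \<theta>)"
  show "z \<in> {(v, w). w = v + \<theta>}"
  proof (rule ccontr)
    assume nz: "z \<notin> {(v, w). w = v + \<theta>}"
    have "closed {z :: real \<times> real. snd z = fst z + \<theta>}"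
      by (intro closed_Collect_eq continuous_intros)
    then have op: "open (- {(v, w). w = v + \<theta>})"
      by (simp add: closed_def case_prod_beta')
    then have "emeasure (shift_measure \<theta>) (- {(v, w). w = v + \<theta>}) > 0"
      using z nz by (auto simp: measure_support_def)
    moreover have "emeasure (shift_measure \<theta>) (- {(v, w). w = v + \<theta>}) = 0"
      by (subst emeasure_shift_measure) (use op in auto)
    ultimately show False by simp
  qed
next
  fix z assume "z \<in> {(v, w). w = v + \<theta>}"
  then obtain v where v: "z = (v, v + \<theta>)" by auto
  show "z \<in> measure_support (shift_measure \<theta>)"
    unfolding measure_support_def
  proof (clarify)
    fix U :: "(real \<times> real) set" assume U: "open U" "z \<in> U"
    have op: "open ((\<lambda>v. (v, v + \<theta>)) -` U)"
      using U(1) by (intro open_vimage continuous_intros)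
    have "v \<in> (\<lambda>v. (v, v + \<theta>)) -` U" using U v by simp
    with op have "(\<lambda>v. (v, v + \<theta>)) -` U \<notin> null_sets lborel"
      using open_not_negligible null_sets_completionI negligible_iff_null_sets by (metis empty_iff)
    then have "emeasure lborel ((\<lambda>v. (v, v + \<theta>)) -` U) \<noteq> 0"
      using op by (auto simp: null_sets_def)
    then show "0 < emeasure (shift_measure \<theta>) U"
      using U by (simp add: emeasure_shift_measure vimage_def zero_less_iff_neq_zero)
  qed
qed (rule normal_plan_shift_measure)

section \<open>Monotone plans are conjugates of shift plans\<close>

context two_unit_mass_measures
begin

lemma quadrants_finite:
  assumes tp: "transport_plan \<mu>0 \<mu>1 \<gamma>"
  shows "emeasure \<gamma> ({..x} \<times> {y<..}) < \<infinity>" "emeasure \<gamma> ({x<..} \<times> {..y}) < \<infinity>"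
proof -
  note s = transport_planD(1)[OF tp]
  have bound: "emeasure \<gamma> X < \<infinity>"
    if "emeasure \<gamma> Y = 0" "X \<subseteq> Y \<union> UNIV \<times> {a<..b}" "Y \<in> sets borel" for X Y a b
  proof -
    have m: "UNIV \<times> {a<..b} \<in> sets \<gamma>" "Y \<in> sets \<gamma>" using that(3) by (simp_all add: s borel_Times)
    have "emeasure \<gamma> X \<le> emeasure \<gamma> (Y \<union> UNIV \<times> {a<..b})"
      using that(2) m by (intro emeasure_mono) auto
    also have "\<dots> \<le> emeasure \<gamma> Y + emeasure \<gamma> (UNIV \<times> {a<..b})"
      using m by (intro emeasure_subadditive)
    also have "\<dots> = emeasure \<mu>1 {a<..b}" using that(1) transport_planD(4)[OF tp] by simp
    finally show ?thesis using M1.emeasure_Ioc_finite[of a b] by (rule le_less_trans)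
  qed
  obtain z where "emeasure \<gamma> ({..x} \<times> {z<..}) = 0" using tp unfolding transport_plan_iff by blast
  then show "emeasure \<gamma> ({..x} \<times> {y<..}) < \<infinity>"
    by (rule bound[where a = y and b = z]) (auto simp: borel_Times)
  obtain z where "emeasure \<gamma> ({x<..} \<times> {..<z}) = 0" using tp unfolding transport_plan_iff by blast
  then show "emeasure \<gamma> ({x<..} \<times> {..y}) < \<infinity>"
    by (rule bound[where a = "z - 1" and b = y]) (auto simp: borel_Times)
qed

lemma strip_finite:
  assumes tp: "transport_plan \<mu>0 \<mu>1 \<gamma>"
  shows "emeasure \<gamma> ({a<..b} \<times> B) < \<infinity>" "emeasure \<gamma> (A \<times> {a<..b}) < \<infinity>"
proof -
  note s = transport_planD(1)[OF tp]
  have "emeasure \<gamma> ({a<..b} \<times> B) \<le> emeasure \<gamma> ({a<..b} \<times> UNIV)"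
    by (rule emeasure_mono) (auto simp: s borel_Times)
  then show "emeasure \<gamma> ({a<..b} \<times> B) < \<infinity>"
    using M0.emeasure_Ioc_finite[of a b] transport_planD(3)[OF tp, of "{a<..b}"] by simp
  have "emeasure \<gamma> (A \<times> {a<..b}) \<le> emeasure \<gamma> (UNIV \<times> {a<..b})"
    by (rule emeasure_mono) (auto simp: s borel_Times)
  then show "emeasure \<gamma> (A \<times> {a<..b}) < \<infinity>"
    using M1.emeasure_Ioc_finite[of a b] transport_planD(4)[OF tp, of "{a<..b}"] by simp
qed

lemma measure_rectangle_Un:
  assumes tp: "transport_plan \<mu>0 \<mu>1 \<gamma>" and [measurable]: "A \<in> sets borel" "B \<in> sets borel" "C \<in> sets borel"
    and dis: "B \<inter> C = {}"
  shows "emeasure \<gamma> (A \<times> B) < \<infinity> \<Longrightarrow> emeasure \<gamma> (A \<times> C) < \<infinity> \<Longrightarrow>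
      measure \<gamma> (A \<times> (B \<union> C)) = measure \<gamma> (A \<times> B) + measure \<gamma> (A \<times> C)"
    and "emeasure \<gamma> (B \<times> A) < \<infinity> \<Longrightarrow> emeasure \<gamma> (C \<times> A) < \<infinity> \<Longrightarrow>
      measure \<gamma> ((B \<union> C) \<times> A) = measure \<gamma> (B \<times> A) + measure \<gamma> (C \<times> A)"
proof -
  note s = transport_planD(1)[OF tp]
  show "measure \<gamma> (A \<times> (B \<union> C)) = measure \<gamma> (A \<times> B) + measure \<gamma> (A \<times> C)"
    if "emeasure \<gamma> (A \<times> B) < \<infinity>" "emeasure \<gamma> (A \<times> C) < \<infinity>"
    using that dis unfolding Sigma_Un_distrib2 
    by (intro measure_Union) (auto simp: s borel_Times)
  show "measure \<gamma> ((B \<union> C) \<times> A) = measure \<gamma> (B \<times> A) + measure \<gamma> (C \<times> A)"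
    if "emeasure \<gamma> (B \<times> A) < \<infinity>" "emeasure \<gamma> (C \<times> A) < \<infinity>"
    using that dis unfolding Times_Un_distrib1
    by (intro measure_Union) (auto simp: s borel_Times)
qed

text \<open>The flux of a plan through the corner \<open>(x, y)\<close>: the mass sent from \<open>{..x}\<close> to \<open>{y<..}\<close>, minus
  the mass sent back from \<open>{x<..}\<close> to \<open>{..y}\<close>.  Moving the corner changes it by masses of the
  marginals only, so it is the same for all plans up to an additive constant.\<close>

lemma flux_formula:
  assumes tp: "transport_plan \<mu>0 \<mu>1 \<gamma>"
  shows "\<exists>\<theta>. \<forall>x y. measure \<gamma> ({..x} \<times> {y<..}) - measure \<gamma> ({x<..} \<times> {..y}) =
    dist_fun \<mu>0 x - dist_fun \<mu>1 y + \<theta>"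
proof -
  define D where "D x y = measure \<gamma> ({..x} \<times> {y<..}) - measure \<gamma> ({x<..} \<times> {..y})" for x y
  note un = measure_rectangle_Un[OF tp] and q = quadrants_finite[OF tp] and st = strip_finite[OF tp]
  have marg: "measure \<gamma> ({a<..b} \<times> UNIV) = dist_fun \<mu>0 b - dist_fun \<mu>0 a"
      "measure \<gamma> (UNIV \<times> {a<..b}) = dist_fun \<mu>1 b - dist_fun \<mu>1 a" if "a \<le> b" for a b
    using that M0.dist_fun_diff M1.dist_fun_diff transport_planD(3,4)[OF tp]
    by (simp_all add: measure_def)
  have D0: "D x' y = D x y + (dist_fun \<mu>0 x' - dist_fun \<mu>0 x)" if "x \<le> x'" for x x' y
  proof -
    have e: "{..x'} = {..x} \<union> {x<..x'}" "{x<..} = {x'<..} \<union> {x<..x'}" "(UNIV :: real set) = {y<..} \<union> {..y}"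
      using that by auto
    have "measure \<gamma> ({..x'} \<times> {y<..}) = measure \<gamma> ({..x} \<times> {y<..}) + measure \<gamma> ({x<..x'} \<times> {y<..})"
      unfolding e(1) by (rule un) (use q st in auto)
    moreover have "measure \<gamma> ({x<..} \<times> {..y}) = measure \<gamma> ({x'<..} \<times> {..y}) + measure \<gamma> ({x<..x'} \<times> {..y})"
      unfolding e(2) by (rule un) (use q st in auto)
    moreover have "measure \<gamma> ({x<..x'} \<times> UNIV) = measure \<gamma> ({x<..x'} \<times> {y<..}) + measure \<gamma> ({x<..x'} \<times> {..y})"
      unfolding e(3) by (rule un) (use q st in auto)
    ultimately show ?thesis using marg(1)[OF that] by (simp add: D_def)
  qed
  have D1: "D x y = D x y' + (dist_fun \<mu>1 y' - dist_fun \<mu>1 y)" if "y \<le> y'" for x y y'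
  proof -
    have e: "{y<..} = {y'<..} \<union> {y<..y'}" "{..y'} = {..y} \<union> {y<..y'}" "(UNIV :: real set) = {x<..} \<union> {..x}"
      using that by auto
    have "measure \<gamma> ({..x} \<times> {y<..}) = measure \<gamma> ({..x} \<times> {y'<..}) + measure \<gamma> ({..x} \<times> {y<..y'})"
      unfolding e(1) by (rule un) (use q st in auto)
    moreover have "measure \<gamma> ({x<..} \<times> {..y'}) = measure \<gamma> ({x<..} \<times> {..y}) + measure \<gamma> ({x<..} \<times> {y<..y'})"
      unfolding e(2) by (rule un) (use q st in auto)
    moreover have "measure \<gamma> (UNIV \<times> {y<..y'}) = measure \<gamma> ({x<..} \<times> {y<..y'}) + measure \<gamma> ({..x} \<times> {y<..y'})"
      unfolding e(3) by (rule un) (use q st in auto)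
    ultimately show ?thesis using marg(2)[OF that] by (simp add: D_def)
  qed
  have D: "D x y = dist_fun \<mu>0 x - dist_fun \<mu>1 y + D 0 0" for x y
  proof -
    have z: "dist_fun \<mu>0 0 = 0" "dist_fun \<mu>1 0 = 0" by (simp_all add: dist_fun_def)
    have "D x y = D 0 y + dist_fun \<mu>0 x"
    proof (cases "0 \<le> x")
      case True
      from D0[OF this, of y] show ?thesis using z by linarith
    next
      case False
      with D0[of x 0 y] show ?thesis using z by linarith
    qed
    moreover have "D 0 y = D 0 0 - dist_fun \<mu>1 y"
    proof (cases "0 \<le> y")
      case True
      from D1[OF this, of 0] show ?thesis using z by linarith
    next
      case False
      with D1[of y 0 0] show ?thesis using z by linarith
    qed
    ultimately show ?thesis by simp
  qed
  show ?thesis by (intro exI[of _ "D 0 0"] allI) (unfold D_def[symmetric], rule D)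
qed

text \<open>If one of the two masses in the flux vanishes at every corner, then the other one is the positive or
  the negative part of the flux.  Here \<open>ennreal\<close> sends negative reals to \<open>0\<close>, so it takes positive parts.\<close>

lemma emeasure_quadrant_of_monotone:
  assumes tp: "transport_plan \<mu>0 \<mu>1 \<gamma>"
    and mono: "\<And>x y. emeasure \<gamma> ({..x} \<times> {y<..}) = 0 \<or> emeasure \<gamma> ({x<..} \<times> {..y}) = 0"
  shows "\<exists>\<theta>. \<forall>x y. emeasure \<gamma> ({..x} \<times> {y<..}) = ennreal (dist_fun \<mu>0 x - dist_fun \<mu>1 y + \<theta>)"
proof -
  obtain \<theta> where \<theta>: "\<And>x y. measure \<gamma> ({..x} \<times> {y<..}) - measure \<gamma> ({x<..} \<times> {..y}) =
    dist_fun \<mu>0 x - dist_fun \<mu>1 y + \<theta>" using flux_formula[OF tp] by auto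
  have "emeasure \<gamma> ({..x} \<times> {y<..}) = ennreal (dist_fun \<mu>0 x - dist_fun \<mu>1 y + \<theta>)" for x y
  proof (cases "emeasure \<gamma> ({..x} \<times> {y<..}) = 0")
    case True
    then have "dist_fun \<mu>0 x - dist_fun \<mu>1 y + \<theta> \<le> 0" unfolding \<theta>[symmetric] by (simp add: measure_def)
    then show ?thesis using True by (simp add: ennreal_neg)
  next
    case False
    then have "emeasure \<gamma> ({x<..} \<times> {..y}) = 0" using mono by blast
    then show ?thesis
      using quadrants_finite(1)[OF tp, of x y] unfolding \<theta>[symmetric]
      by (simp add: measure_def[of _ "{x<..} \<times> {..y}"] emeasure_eq_ennreal_measure)
  qed
  then show ?thesis by blast
qed

text \<open>The mass of a bounded half-open rectangle is an alternating sum of masses of quadrants.\<close>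

lemma emeasure_rectangle_eq_of_quadrants:
  assumes tp: "transport_plan \<mu>0 \<mu>1 \<gamma>" "transport_plan \<mu>0 \<mu>1 \<gamma>'"
    and eq: "\<And>x y. emeasure \<gamma> ({..x} \<times> {y<..}) = emeasure \<gamma>' ({..x} \<times> {y<..})"
    and AB: "A \<in> sets borel" "B \<in> sets borel"
  shows "emeasure \<gamma> (A \<times> B) = emeasure \<gamma>' (A \<times> B)"
proof (rule emeasure_rectangle_eq_of_Ioc)
  fix a b c d :: real
  show "emeasure \<gamma> ({a<..b} \<times> {c<..d}) = emeasure \<gamma>' ({a<..b} \<times> {c<..d})"
  proof (cases "a \<le> b \<and> c \<le> d")
    case True
    have "measure \<kappa> ({a<..b} \<times> {c<..d}) = measure \<kappa> ({..b} \<times> {c<..}) - measure \<kappa> ({..a} \<times> {c<..})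
        - (measure \<kappa> ({..b} \<times> {d<..}) - measure \<kappa> ({..a} \<times> {d<..}))"
      if \<kappa>: "transport_plan \<mu>0 \<mu>1 \<kappa>" for \<kappa>
    proof -
      note un = measure_rectangle_Un[OF \<kappa>] and q = quadrants_finite[OF \<kappa>] and st = strip_finite[OF \<kappa>]
      have e: "{..b} = {..a} \<union> {a<..b}" "{c<..} = {c<..d} \<union> {d<..}" using True by auto
      have "measure \<kappa> ({..b} \<times> {y<..}) = measure \<kappa> ({..a} \<times> {y<..}) + measure \<kappa> ({a<..b} \<times> {y<..})" for y
        unfolding e(1) by (rule un) (use q st in auto)
      moreover have "measure \<kappa> ({a<..b} \<times> {c<..}) = measure \<kappa> ({a<..b} \<times> {c<..d}) + measure \<kappa> ({a<..b} \<times> {d<..})"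
        unfolding e(2) by (rule un) (use q st in auto)
      ultimately show ?thesis by simp
    qed
    then have "measure \<gamma> ({a<..b} \<times> {c<..d}) = measure \<gamma>' ({a<..b} \<times> {c<..d})"
      using tp by (simp add: measure_def eq)
    moreover have "emeasure \<kappa> ({a<..b} \<times> {c<..d}) = ennreal (measure \<kappa> ({a<..b} \<times> {c<..d}))"
      if "transport_plan \<mu>0 \<mu>1 \<kappa>" for \<kappa>
      using strip_finite(1)[OF that, of a b "{c<..d}"]
      by (auto intro!: emeasure_eq_ennreal_measure)
    ultimately show ?thesis using tp by simp
  qed auto
  show "emeasure \<gamma> ({a<..b} \<times> UNIV) < \<infinity>"
    by (rule strip_finite[OF tp(1)])
qed (use transport_planD(1) tp AB in auto)

lemma emeasure_quadrant_conj_shift_measure: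
  "emeasure (conj_measure \<mu>0 \<mu>1 (shift_measure \<theta>)) ({..x} \<times> {y<..}) =
   ennreal (dist_fun \<mu>0 x - dist_fun \<mu>1 y + \<theta>)"
proof -
  let ?X = "dist_fun_inv \<mu>0 -` {..x}" and ?Y = "dist_fun_inv \<mu>1 -` {y<..}"
  have m: "?X \<times> ?Y \<in> sets borel"
    by (intro borel_Times M0.vimage_dist_fun_inv_borel M1.vimage_dist_fun_inv_borel) auto
  have "emeasure (conj_measure \<mu>0 \<mu>1 (shift_measure \<theta>)) ({..x} \<times> {y<..}) =
      emeasure lborel {v. (v, v + \<theta>) \<in> ?X \<times> ?Y}"
    by (simp add: emeasure_conj_measure[OF normal_plan_shift_measure] emeasure_shift_measure m)
  also have "\<dots> = ennreal (dist_fun \<mu>0 x - (dist_fun \<mu>1 y - \<theta>))"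
  proof (rule emeasure_lborel_between)
    have "(\<lambda>v. (v, v + \<theta>)) \<in> borel_measurable borel" by (intro borel_measurable_Pair) auto
    from measurable_sets[OF this m] show "{v. (v, v + \<theta>) \<in> ?X \<times> ?Y} \<in> sets borel"
      by (simp add: vimage_def)
    show "{v. (v, v + \<theta>) \<in> ?X \<times> ?Y} \<subseteq> {dist_fun \<mu>1 y - \<theta>..dist_fun \<mu>0 x}"
    proof
      fix v assume "v \<in> {v. (v, v + \<theta>) \<in> ?X \<times> ?Y}"
      then have v: "dist_fun_inv \<mu>0 v \<le> x" "y < dist_fun_inv \<mu>1 (v + \<theta>)" by auto
      show "v \<in> {dist_fun \<mu>1 y - \<theta>..dist_fun \<mu>0 x}"
        using M0.le_dist_fun[OF v(1)] M1.dist_fun_le[OF v(2)] by simp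
    qed
    show "{dist_fun \<mu>1 y - \<theta><..<dist_fun \<mu>0 x} \<subseteq> {v. (v, v + \<theta>) \<in> ?X \<times> ?Y}"
    proof
      fix v assume "v \<in> {dist_fun \<mu>1 y - \<theta><..<dist_fun \<mu>0 x}"
      then have v: "v < dist_fun \<mu>0 x" "dist_fun \<mu>1 y < v + \<theta>" by auto
      show "v \<in> {v. (v, v + \<theta>) \<in> ?X \<times> ?Y}"
        using M0.dist_fun_inv_le[OF v(1)] M1.dist_fun_inv_greater[OF v(2)] by simp
    qed
  qed
  finally show ?thesis by (simp add: algebra_simps)
qed

lemma monotone_plan_conjugate_shift:
  assumes tp: "transport_plan \<mu>0 \<mu>1 \<gamma>"
    and mono: "\<And>x y. emeasure \<gamma> ({..x} \<times> {y<..}) = 0 \<or> emeasure \<gamma> ({x<..} \<times> {..y}) = 0"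
  shows "\<exists>\<theta>. conjugate_plan \<mu>0 \<mu>1 (shift_measure \<theta>) \<gamma>"
proof -
  from emeasure_quadrant_of_monotone[OF assms] obtain \<theta> where
    \<theta>: "\<forall>x y. emeasure \<gamma> ({..x} \<times> {y<..}) = ennreal (dist_fun \<mu>0 x - dist_fun \<mu>1 y + \<theta>)" ..
  have "emeasure \<gamma> (A \<times> B) = emeasure (conj_measure \<mu>0 \<mu>1 (shift_measure \<theta>)) (A \<times> B)"
    if "A \<in> sets borel" "B \<in> sets borel" for A B
    using tp transport_plan_conj_measure[OF normal_plan_shift_measure] _ that
    by (rule emeasure_rectangle_eq_of_quadrants)
      (simp only: \<theta> emeasure_quadrant_conj_shift_measure)
  then show ?thesis using tp by (auto simp: conjugate_plan_iff[OF normal_plan_shift_measure])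
qed

end

section \<open>Local optimality forces monotonicity\<close>

lemma open_lower_semicontinuous:
  assumes "lower_semicontinuous f"
  shows "open {x. a < f x}"
  unfolding open_subopen[of "{x. a < f x}"]
proof
  fix x assume "x \<in> {x. a < f x}"
  then have "\<forall>\<^sub>F y in nhds x. a < f y" using assms by (simp add: lower_semicontinuous_def)
  then obtain S where "open S" "x \<in> S" "\<forall>y\<in>S. a < f y" by (auto simp: eventually_nhds)
  then show "\<exists>T. open T \<and> x \<in> T \<and> T \<subseteq> {x. a < f x}" by (intro exI[of _ S]) auto
qed

lemma borel_measurable_lower_semicontinuous:
  "lower_semicontinuous f \<Longrightarrow> f \<in> borel_measurable borel"
  by (rule borel_measurableI_greater) (simp add: open_lower_semicontinuous)

lemma lower_semicontinuous_bounded_below: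
  assumes lsc: "lower_semicontinuous f" and K: "compact K"
  shows "\<exists>M. \<forall>x\<in>K. - M \<le> f x"
proof -
  let ?U = "\<lambda>n::nat. {x. - real n < f x}"
  have "open (?U n)" for n using lsc by (rule open_lower_semicontinuous)
  moreover have "K \<subseteq> (\<Union>n\<in>UNIV. ?U n)"
  proof
    fix x
    obtain n where "- f x < real n" using reals_Archimedean2 by blast
    then have "x \<in> ?U n" by simp
    then show "x \<in> (\<Union>n\<in>UNIV. ?U n)" by blast
  qed
  ultimately obtain N where N: "finite N" "K \<subseteq> (\<Union>n\<in>N. ?U n)"
    using compactE_image[OF K, of UNIV ?U] by metis
  have "- real (Max N) \<le> f x" if "x \<in> K" for x
  proof -
    obtain n where "n \<in> N" "- real n < f x" using N(2) \<open>x \<in> K\<close> by blast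
    moreover have "n \<le> Max N" using \<open>n \<in> N\<close> N(1) by simp
    ultimately show ?thesis by linarith
  qed
  then show ?thesis by blast
qed

context two_unit_mass_measures
begin

lemma conjugate_cost_measurable:
  assumes "c \<in> borel_measurable borel"
  shows "conjugate_cost \<mu>0 \<mu>1 c \<in> borel_measurable borel"
proof -
  have "(\<lambda>z. (dist_fun_inv \<mu>0 (fst z), dist_fun_inv \<mu>1 (snd z))) \<in> borel_measurable borel"
    by (intro borel_measurable_Pair) measurable
  from measurable_compose[OF this assms] show ?thesis
    by (simp add: conjugate_cost_def case_prod_beta')
qed

lemma conjugate_cost_bounded_below:
  assumes "lower_semicontinuous c"
  shows "\<exists>M. \<forall>x\<in>{a..b}. \<forall>y\<in>{a'..b'}. - M \<le> conjugate_cost \<mu>0 \<mu>1 c (x, y)"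
proof -
  let ?K = "{dist_fun_inv \<mu>0 a..dist_fun_inv \<mu>0 b} \<times> {dist_fun_inv \<mu>1 a'..dist_fun_inv \<mu>1 b'}"
  obtain M where M: "\<forall>z\<in>?K. - M \<le> c z"
    using lower_semicontinuous_bounded_below[OF assms, of ?K] compact_Times[OF compact_Icc compact_Icc] by blast
  have K: "(dist_fun_inv \<mu>0 x, dist_fun_inv \<mu>1 y) \<in> ?K" if "x \<in> {a..b}" "y \<in> {a'..b'}" for x y
    using that by (simp add: M0.dist_fun_inv_mono M1.dist_fun_inv_mono)
  have "- M \<le> conjugate_cost \<mu>0 \<mu>1 c (x, y)" if "x \<in> {a..b}" "y \<in> {a'..b'}" for x y
    using bspec[OF M K[OF that]] by (simp add: conjugate_cost_def)
  then show ?thesis by blast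
qed

text \<open>Where an inverse distribution function is constant the inequality degenerates to an equality.\<close>

lemma conjugate_cost_monge:
  assumes "monge c" "v1 \<le> v2" "w1 \<le> w2"
  shows "conjugate_cost \<mu>0 \<mu>1 c (v1, w1) + conjugate_cost \<mu>0 \<mu>1 c (v2, w2) \<le>
         conjugate_cost \<mu>0 \<mu>1 c (v1, w2) + conjugate_cost \<mu>0 \<mu>1 c (v2, w1)"
proof -
  have "dist_fun_inv \<mu>0 v1 = dist_fun_inv \<mu>0 v2 \<or> dist_fun_inv \<mu>0 v1 < dist_fun_inv \<mu>0 v2"
    "dist_fun_inv \<mu>1 w1 = dist_fun_inv \<mu>1 w2 \<or> dist_fun_inv \<mu>1 w1 < dist_fun_inv \<mu>1 w2"
    using M0.dist_fun_inv_mono[OF assms(2)] M1.dist_fun_inv_mono[OF assms(3)] by auto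
  then show ?thesis using assms(1)
    by (auto simp: conjugate_cost_def monge_def intro: less_imp_le)
qed

lemma locally_optimal_conjugate_shift:
  assumes c: "lower_semicontinuous c" "monge c" and lo: "locally_optimal \<mu>0 \<mu>1 c \<gamma>"
  shows "\<exists>\<theta>. conjugate_plan \<mu>0 \<mu>1 (shift_measure \<theta>) \<gamma>"
proof (rule monotone_plan_conjugate_shift)
  show "transport_plan \<mu>0 \<mu>1 \<gamma>" using lo by (simp add: locally_optimal_def)
  show "emeasure \<gamma> ({..x} \<times> {y<..}) = 0 \<or> emeasure \<gamma> ({x<..} \<times> {..y}) = 0" for x y
  proof (rule locally_optimal_separated[OF lo borel_measurable_lower_semicontinuous[OF c(1)]])
    show "\<exists>M. \<forall>x\<in>{-r..r}. \<forall>y\<in>{-r..r}. - M \<le> c (x, y)" for r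
      using lower_semicontinuous_bounded_below[OF c(1) compact_Times[OF compact_Icc compact_Icc]] by force
    show "c (x1, y2) + c (x2, y1) < c (x1, y1) + c (x2, y2)"
      if "x1 \<in> {..x}" "y1 \<in> {y<..}" "x2 \<in> {x<..}" "y2 \<in> {..y}" for x1 y1 x2 y2
    proof -
      have "x1 < x2" "y2 < y1" using that by auto
      then show ?thesis using c(2) unfolding monge_def by blast
    qed
  qed auto
qed

text \<open>Although the conjugate cost satisfies the Monge condition only weakly, the inequality is strict between
  preimages of separated half-lines.  Hence it is the conjugate of the given plan, rather than the plan
  itself, that turns out to be monotone.\<close>

lemma locally_optimal_normal_equivalent_shift:
  assumes c: "lower_semicontinuous c" "monge c"
    and lo: "locally_optimal lborel lborel (conjugate_cost \<mu>0 \<mu>1 c) \<nu>"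
  shows "\<exists>\<theta>. equivalent_plans \<mu>0 \<mu>1 \<nu> (shift_measure \<theta>)"
proof -
  have \<nu>: "normal_plan \<nu>" using lo by (simp add: locally_optimal_def normal_plan_def)
  let ?\<gamma> = "conj_measure \<mu>0 \<mu>1 \<nu>"
  have tp: "transport_plan \<mu>0 \<mu>1 ?\<gamma>" by (rule transport_plan_conj_measure[OF \<nu>])
  have "\<exists>\<theta>. conjugate_plan \<mu>0 \<mu>1 (shift_measure \<theta>) ?\<gamma>"
  proof (rule monotone_plan_conjugate_shift[OF tp])
    fix x y
    let ?G0 = "dist_fun_inv \<mu>0" and ?G1 = "dist_fun_inv \<mu>1"
    have "emeasure \<nu> (?G0 -` {..x} \<times> ?G1 -` {y<..}) = 0 \<or> emeasure \<nu> (?G0 -` {x<..} \<times> ?G1 -` {..y}) = 0"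
    proof (rule locally_optimal_separated[OF lo])
      show "conjugate_cost \<mu>0 \<mu>1 c \<in> borel_measurable borel"
        by (intro conjugate_cost_measurable borel_measurable_lower_semicontinuous c)
      show "\<exists>M. \<forall>x\<in>{-r..r}. \<forall>y\<in>{-r..r}. - M \<le> conjugate_cost \<mu>0 \<mu>1 c (x, y)" for r
        by (rule conjugate_cost_bounded_below[OF c(1)])
      show "conjugate_cost \<mu>0 \<mu>1 c (x1, y2) + conjugate_cost \<mu>0 \<mu>1 c (x2, y1) <
          conjugate_cost \<mu>0 \<mu>1 c (x1, y1) + conjugate_cost \<mu>0 \<mu>1 c (x2, y2)"
        if "x1 \<in> ?G0 -` {..x}" "y1 \<in> ?G1 -` {y<..}" "x2 \<in> ?G0 -` {x<..}" "y2 \<in> ?G1 -` {..y}" for x1 y1 x2 y2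
      proof -
        have "?G0 x1 < ?G0 x2" "?G1 y2 < ?G1 y1" using that by auto
        then show ?thesis using c(2) unfolding monge_def conjugate_cost_def by simp
      qed
    qed (auto intro!: M0.vimage_dist_fun_inv_borel M1.vimage_dist_fun_inv_borel)
    then show "emeasure ?\<gamma> ({..x} \<times> {y<..}) = 0 \<or> emeasure ?\<gamma> ({x<..} \<times> {..y}) = 0"
      by (simp add: emeasure_conj_measure[OF \<nu>])
  qed
  then obtain \<theta> where "conjugate_plan \<mu>0 \<mu>1 (shift_measure \<theta>) ?\<gamma>" ..
  moreover have "conjugate_plan \<mu>0 \<mu>1 \<nu> ?\<gamma>" using tp by (simp add: conjugate_plan_iff[OF \<nu>])
  ultimately show ?thesis using \<nu> normal_plan_shift_measure by (auto simp: equivalent_plans_def)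
qed

end

section \<open>Potentials for a Monge cost along a line\<close>

text \<open>Sums of increments of a kernel along finite increasing chains \<open>a = v\<^sub>0 \<le> \<dots> \<le> v\<^sub>n\<close>, each increment
  being taken in the first variable with the second one frozen at the left end point.\<close>

inductive chain_sum :: "(real \<Rightarrow> real \<Rightarrow> real) \<Rightarrow> real \<Rightarrow> real \<Rightarrow> real \<Rightarrow> bool" for H a where
  start: "chain_sum H a a 0"
| extend: "chain_sum H a v t \<Longrightarrow> v \<le> w \<Longrightarrow> chain_sum H a w (t + (H w v - H v v))"

text \<open>A function \<open>u\<close> whose increments dominate those of \<open>H\<close> with the second variable frozen.  For a smooth
  kernel \<open>u\<close> would be the integral of the first partial derivative along the diagonal.  As refining a
  chain increases its sum, the supremum over all chains takes the place of this integral, and no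
  regularity is needed.\<close>

lemma diagonal_potential:
  fixes H :: "real \<Rightarrow> real \<Rightarrow> real"
  assumes z1: "\<And>w. a \<le> w \<Longrightarrow> H a w = 0" and z2: "\<And>v. a \<le> v \<Longrightarrow> H v a = 0"
    and incr: "\<And>v1 v2 w1 w2. a \<le> v1 \<Longrightarrow> v1 \<le> v2 \<Longrightarrow> a \<le> w1 \<Longrightarrow> w1 \<le> w2 \<Longrightarrow>
      H v1 w2 + H v2 w1 \<le> H v1 w1 + H v2 w2"
  shows "\<exists>u. (\<forall>v\<ge>a. \<forall>w\<ge>a. H v w \<le> u v - u w + H w w) \<and>
    (\<forall>v w. a \<le> v \<longrightarrow> v \<le> w \<longrightarrow> u v \<le> u w) \<and> (\<forall>v\<ge>a. 0 \<le> u v \<and> u v \<le> H v v)"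
proof -
  let ?C = "chain_sum H a"
  define u where "u w = Sup {t. ?C w t}" for w
  have ge: "a \<le> w" if "?C w t" for w t
    using that by induction auto
  have H_mono: "H v w \<le> H v' w" "H w v \<le> H w v'" if "a \<le> v" "v \<le> v'" "a \<le> w" for v v' w
    using incr[of v v' a w] incr[of a w v v'] z1 z2 that by auto
  have bound: "t \<le> H w w" if "?C w t" for w t
    using that
  proof induction
    case (extend v t w)
    then show ?case using H_mono(2)[of v w w] ge by fastforce
  qed (simp add: z1)
  have bdd: "bdd_above {t. ?C w t}" for w
    using bound by (intro bdd_aboveI[of _ "H w w"]) auto
  have upper: "t \<le> u w" if "?C w t" for w t
    unfolding u_def using that bdd by (intro cSup_upper) auto
  have ne: "{t. ?C w t} \<noteq> {}" if "a \<le> w" for w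
    using chain_sum.extend[OF chain_sum.start that] by blast
  have least: "u w \<le> x" if "a \<le> w" "\<And>t. ?C w t \<Longrightarrow> t \<le> x" for w x
    unfolding u_def using that by (intro cSup_least ne) auto
  have right: "u w + (H v w - H w w) \<le> u v" if "a \<le> w" "w \<le> v" for v w
  proof -
    have "u w \<le> u v - (H v w - H w w)"
      using upper[OF chain_sum.extend] that by (intro least) (fastforce simp: algebra_simps)+
    then show ?thesis by simp
  qed
  have mono: "u v \<le> u w" if "a \<le> v" "v \<le> w" for v w
    using right[OF that] H_mono(1)[of v w v] that by simp
  have nonneg: "0 \<le> u v" if "a \<le> v" for v
    using upper[OF chain_sum.start] mono[of a v] that by simp
  have "t \<le> u v + (H w w - H v w)" if "?C w t" "a \<le> v" "v \<le> w" for v w t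
    using that
  proof (induction arbitrary: v)
    case start
    then show ?case using nonneg[of a] by simp
  next
    case (extend v' t w)
    have a: "a \<le> v'" using ge extend.hyps by blast
    have i: "H v w + H w v' \<le> H v v' + H w w" using incr[of v w v' w] a extend.hyps extend.prems by simp
    show ?case
    proof (cases "v \<le> v'")
      case True
      then show ?thesis using extend.IH[of v] extend.prems i by linarith
    next
      case False
      then show ?thesis using upper[OF chain_sum.extend[OF extend.hyps(1), of v]] i by linarith
    qed
  qed
  then have left: "u w \<le> u v + (H w w - H v w)" if "a \<le> v" "v \<le> w" for v w
    using that by (intro least) auto
  have "H v w \<le> u v - u w + H w w" if "a \<le> v" "a \<le> w" for v w
    using left[of v w] right[of w v] that by (cases "v \<le> w") auto
  moreover have "u v \<le> H v v" if "a \<le> v" for v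
    using that bound by (intro least)
  ultimately show ?thesis using mono nonneg by (intro exI[of _ u]) auto
qed

text \<open>Functions \<open>p\<close> and \<open>q\<close> with \<open>p v + q w \<le> k (v, w)\<close> on a square and equality on its diagonal.  Subtracting
  from a Monge cost its values on two sides of the square leaves the negative of a kernel \<open>H\<close> that
  is nondecreasing in both variables, hence bounded on the square however irregular the cost is; so \<open>p\<close> and
  \<open>q\<close> inherit lower bounds from the cost.\<close>

lemma monge_potentials:
  fixes k :: "real \<times> real \<Rightarrow> real"
  assumes k [measurable]: "k \<in> borel_measurable borel"
    and monge: "\<And>v1 v2 w1 w2. v1 \<le> v2 \<Longrightarrow> w1 \<le> w2 \<Longrightarrow> k (v1, w1) + k (v2, w2) \<le> k (v1, w2) + k (v2, w1)"
    and below: "\<And>v w. v \<in> {a..b} \<Longrightarrow> w \<in> {a..b} \<Longrightarrow> - M \<le> k (v, w)"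
  shows "\<exists>p q L. p \<in> borel_measurable borel \<and> q \<in> borel_measurable borel \<and>
    (\<forall>v\<in>{a..b}. \<forall>w\<in>{a..b}. p v + q w \<le> k (v, w)) \<and> (\<forall>v\<in>{a..b}. p v + q v = k (v, v)) \<and>
    (\<forall>v\<in>{a..b}. - L \<le> p v \<and> - L \<le> q v)"
proof -
  define H where "H v w = k (v, a) + k (a, w) - k (a, a) - k (v, w)" for v w
  have incr: "H v1 w2 + H v2 w1 \<le> H v1 w1 + H v2 w2" if "v1 \<le> v2" "w1 \<le> w2" for v1 v2 w1 w2
    using monge[OF that] by (simp add: H_def)
  have "\<exists>u. (\<forall>v\<ge>a. \<forall>w\<ge>a. H v w \<le> u v - u w + H w w) \<and>
    (\<forall>v w. a \<le> v \<longrightarrow> v \<le> w \<longrightarrow> u v \<le> u w) \<and> (\<forall>v\<ge>a. 0 \<le> u v \<and> u v \<le> H v v)"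
    by (rule diagonal_potential) (simp_all add: incr, simp_all add: H_def)
  then obtain u where u: "\<And>v w. a \<le> v \<Longrightarrow> a \<le> w \<Longrightarrow> H v w \<le> u v - u w + H w w"
    "\<And>v w. a \<le> v \<Longrightarrow> v \<le> w \<Longrightarrow> u v \<le> u w" "\<And>v. a \<le> v \<Longrightarrow> 0 \<le> u v \<and> u v \<le> H v v"
    by (elim exE conjE) blast
  define u' where "u' v = u (max a v)" for v
  have u'_eq: "u' v = u v" if "a \<le> v" for v using that by (simp add: u'_def)
  have u' [measurable]: "u' \<in> borel_measurable borel"
    by (rule borel_measurable_mono) (auto simp: mono_def u'_def intro!: u(2))
  have [measurable]: "(\<lambda>v. k (f v, g v)) \<in> borel_measurable borel"
    if "f \<in> borel_measurable borel" "g \<in> borel_measurable borel" for f g :: "real \<Rightarrow> real"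
    using measurable_compose[OF borel_measurable_Pair[OF that] k] .
  define p q where "p v = k (v, a) - u' v" and "q w = k (a, w) - k (a, a) - H w w + u' w" for v w
  \<comment> \<open>The three terms bound the side values, the corner value and the kernel.\<close>
  define L where "L = M + \<bar>k (a, a)\<bar> + H b b"
  have Hd: "0 \<le> H v v" "H v v \<le> H b b" if "v \<in> {a..b}" for v
    using incr[of a v a v] incr[of v b a v] incr[of a b v b] that by (auto simp: H_def)
  have "- L \<le> p v \<and> - L \<le> q v" if v: "v \<in> {a..b}" for v
  proof -
    have "- M \<le> k (v, a)" "- M \<le> k (a, v)" using v by (auto intro!: below)
    moreover have "0 \<le> u v" "u v \<le> H v v" using u(3)[of v] v by auto
    ultimately show ?thesis using Hd[OF v] v unfolding p_def q_def L_def by (auto simp: u'_eq)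
  qed
  moreover have "p v + q w \<le> k (v, w)" if "v \<in> {a..b}" "w \<in> {a..b}" for v w
  proof -
    have "k (v, a) + k (a, w) - k (a, a) - k (v, w) \<le> u v - u w + H w w"
      using u(1)[of v w] that by (simp add: H_def[of v w])
    then show ?thesis using that by (simp add: p_def q_def u'_eq)
  qed
  moreover have "p v + q v = k (v, v)" for v by (simp add: p_def q_def H_def)
  moreover have "p \<in> borel_measurable borel" "q \<in> borel_measurable borel"
    unfolding p_def q_def H_def by measurable
  ultimately show ?thesis by blast
qed

section \<open>Shift plans are locally optimal\<close>

lemma nn_integral_fst_snd_eq:
  fixes \<sigma> \<tau> :: "(real \<times> real) measure"
  assumes s: "sets \<sigma> = sets borel" "sets \<tau> = sets borel" and f: "f \<in> borel_measurable borel"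
  shows "(\<And>A. A \<in> sets borel \<Longrightarrow> emeasure \<sigma> (A \<times> UNIV) = emeasure \<tau> (A \<times> UNIV)) \<Longrightarrow>
      (\<integral>\<^sup>+z. f (fst z) \<partial>\<sigma>) = (\<integral>\<^sup>+z. f (fst z) \<partial>\<tau>)"
    and "(\<And>A. A \<in> sets borel \<Longrightarrow> emeasure \<sigma> (UNIV \<times> A) = emeasure \<tau> (UNIV \<times> A)) \<Longrightarrow>
      (\<integral>\<^sup>+z. f (snd z) \<partial>\<sigma>) = (\<integral>\<^sup>+z. f (snd z) \<partial>\<tau>)"
proof -
  note [measurable_cong] = s
  have sp: "space \<sigma> = UNIV" "space \<tau> = UNIV"
    using sets_eq_imp_space_eq[OF s(1)] sets_eq_imp_space_eq[OF s(2)] by simp_all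
  have pre: "fst -` A = A \<times> UNIV" "snd -` A = UNIV \<times> A" for A :: "real set" by auto
  {
    assume "\<And>A. A \<in> sets borel \<Longrightarrow> emeasure \<sigma> (A \<times> UNIV) = emeasure \<tau> (A \<times> UNIV)"
    then have "distr \<sigma> borel fst = distr \<tau> borel fst"
      by (intro measure_eqI) (auto simp: emeasure_distr sp pre)
    then have "(\<integral>\<^sup>+x. f x \<partial>distr \<sigma> borel fst) = (\<integral>\<^sup>+x. f x \<partial>distr \<tau> borel fst)" by simp
    then show "(\<integral>\<^sup>+z. f (fst z) \<partial>\<sigma>) = (\<integral>\<^sup>+z. f (fst z) \<partial>\<tau>)" using f by (simp add: nn_integral_distr)
  next
    assume "\<And>A. A \<in> sets borel \<Longrightarrow> emeasure \<sigma> (UNIV \<times> A) = emeasure \<tau> (UNIV \<times> A)"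
    then have "distr \<sigma> borel snd = distr \<tau> borel snd"
      by (intro measure_eqI) (auto simp: emeasure_distr sp pre)
    then have "(\<integral>\<^sup>+x. f x \<partial>distr \<sigma> borel snd) = (\<integral>\<^sup>+x. f x \<partial>distr \<tau> borel snd)" by simp
    then show "(\<integral>\<^sup>+z. f (snd z) \<partial>\<sigma>) = (\<integral>\<^sup>+z. f (snd z) \<partial>\<tau>)" using f by (simp add: nn_integral_distr)
  }
qed

text \<open>Weak duality: \<open>p v + q (w - \<theta>)\<close> is at most the cost, with equality on the line \<open>w = v + \<theta>\<close>, and its
  integral depends on the marginals only.  The potentials may fail to be integrable, but since they are bounded
  below, everything can be said with extended nonnegative integrals.\<close>

lemma not_signed_integral_neg_of_line:
  fixes c :: "real \<times> real \<Rightarrow> real"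
  assumes c [measurable]: "c \<in> borel_measurable borel"
    and monge: "\<And>v1 v2 w1 w2. v1 \<le> v2 \<Longrightarrow> w1 \<le> w2 \<Longrightarrow> c (v1, w1) + c (v2, w2) \<le> c (v1, w2) + c (v2, w1)"
    and below: "\<And>a b a' b'. \<exists>M. \<forall>v\<in>{a..b}. \<forall>w\<in>{a'..b'}. - M \<le> c (v, w)"
    and s: "sets \<sigma>p = sets borel" "sets \<sigma>n = sets borel"
    and fin: "finite_measure \<sigma>p" "finite_measure \<sigma>n"
    and K: "compact K" "emeasure \<sigma>p (- K) = 0" "emeasure \<sigma>n (- K) = 0"
    and m0: "\<And>A. A \<in> sets borel \<Longrightarrow> emeasure \<sigma>p (A \<times> UNIV) = emeasure \<sigma>n (A \<times> UNIV)"
    and m1: "\<And>A. A \<in> sets borel \<Longrightarrow> emeasure \<sigma>p (UNIV \<times> A) = emeasure \<sigma>n (UNIV \<times> A)"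
    and line: "AE (v, w) in \<sigma>n. w = v + \<theta>"
  shows "\<not> signed_integral_neg c \<sigma>p \<sigma>n"
proof -
  obtain r where r: "0 \<le> r" "K \<subseteq> {-r..r} \<times> {-r..r}" using compact_subset_square[OF K(1)] by metis
  \<comment> \<open>The square with half side R, shifted by the offset in the second variable, contains K.\<close>
  define R where "R = r + \<bar>\<theta>\<bar>"
  let ?k = "\<lambda>z. c (fst z, snd z + \<theta>)"
  obtain M where M: "\<forall>v\<in>{-R..R}. \<forall>w\<in>{-R+\<theta>..R+\<theta>}. - M \<le> c (v, w)" using below by blast
  have "(\<lambda>z::real\<times>real. (fst z, snd z + \<theta>)) \<in> borel_measurable borel"
    by (intro borel_measurable_Pair) measurable
  from measurable_compose[OF this c] have k: "?k \<in> borel_measurable borel" .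
  have mk: "c (v1, w1 + \<theta>) + c (v2, w2 + \<theta>) \<le> c (v1, w2 + \<theta>) + c (v2, w1 + \<theta>)"
    if "v1 \<le> v2" "w1 \<le> w2" for v1 v2 w1 w2
    using that by (intro monge) simp_all
  have bk: "- M \<le> c (v, w + \<theta>)" if "v \<in> {-R..R}" "w \<in> {-R..R}" for v w
    using that by (intro bspec[OF bspec[OF M]]) simp_all
  have "\<exists>p q L. p \<in> borel_measurable borel \<and> q \<in> borel_measurable borel \<and>
    (\<forall>v\<in>{-R..R}. \<forall>w\<in>{-R..R}. p v + q w \<le> c (v, w + \<theta>)) \<and>
    (\<forall>v\<in>{-R..R}. p v + q v = c (v, v + \<theta>)) \<and> (\<forall>v\<in>{-R..R}. - L \<le> p v \<and> - L \<le> q v)"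
    by (rule monge_potentials[OF k, of "-R" R M, unfolded fst_conv snd_conv]) (rule mk bk; assumption)+
  then obtain p q L where pq [measurable]: "p \<in> borel_measurable borel" "q \<in> borel_measurable borel"
    and le: "\<And>v w. v \<in> {-R..R} \<Longrightarrow> w \<in> {-R..R} \<Longrightarrow> p v + q w \<le> c (v, w + \<theta>)"
    and eq: "\<And>v. v \<in> {-R..R} \<Longrightarrow> p v + q v = c (v, v + \<theta>)"
    and L: "\<And>v. v \<in> {-R..R} \<Longrightarrow> - L \<le> p v" "\<And>v. v \<in> {-R..R} \<Longrightarrow> - L \<le> q v"
    by (elim exE conjE) blast
  \<comment> \<open>Adding the constant to each potential makes it nonnegative; the cost then gets twice that constant.\<close>
  define N where "N = max (max L (M / 2)) 0"
  have N: "L \<le> N" "M \<le> 2 * N" "0 \<le> N" by (auto simp: N_def)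
  have AE_box: "AE z in \<sigma>. fst z \<in> {-R..R} \<and> snd z - \<theta> \<in> {-R..R}"
    if "sets \<sigma> = sets borel" "emeasure \<sigma> (- K) = 0" for \<sigma>
  proof (rule AE_I[of _ _ "- K"])
    show "{z \<in> space \<sigma>. \<not> (fst z \<in> {-R..R} \<and> snd z - \<theta> \<in> {-R..R})} \<subseteq> - K"
      using r(2) by (force simp: R_def)
    show "- K \<in> sets \<sigma>" using K(1) that by (simp add: borel_comp borel_compact)
  qed (fact that)
  have c_below: "- (2 * N) \<le> c z" if "fst z \<in> {-R..R} \<and> snd z - \<theta> \<in> {-R..R}" for z
  proof -
    have "- M \<le> c z" using bk[of "fst z" "snd z - \<theta>"] that by simp
    then show ?thesis using N by simp
  qed
  have AE_below: "AE z in \<sigma>p. - (2 * N) \<le> c z"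
    using AE_box[OF s(1) K(2)] by eventually_elim (rule c_below)
  have AE_below': "AE z in \<sigma>n. - (2 * N) \<le> c z"
    using AE_box[OF s(2) K(3)] by eventually_elim (rule c_below)
  define g where "g z = ennreal (p (fst z) + N) + ennreal (q (snd z - \<theta>) + N)" for z :: "real \<times> real"
  have g_eq: "g z = ennreal (p (fst z) + q (snd z - \<theta>) + 2 * N)"
    if "fst z \<in> {-R..R} \<and> snd z - \<theta> \<in> {-R..R}" for z
    using L[of "fst z"] L[of "snd z - \<theta>"] N that by (simp add: g_def ac_simps flip: ennreal_plus)
  have mp: "(\<lambda>x. ennreal (p x + N)) \<in> borel_measurable borel"
    and mq: "(\<lambda>x. ennreal (q (x - \<theta>) + N)) \<in> borel_measurable borel"
    by measurable
  have int_g: "(\<integral>\<^sup>+z. g z \<partial>\<sigma>) = (\<integral>\<^sup>+z. ennreal (p (fst z) + N) \<partial>\<sigma>) + (\<integral>\<^sup>+z. ennreal (q (snd z - \<theta>) + N) \<partial>\<sigma>)"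
    if [measurable_cong]: "sets \<sigma> = sets borel" for \<sigma>
    unfolding g_def by (rule nn_integral_add) measurable
  have "(\<integral>\<^sup>+z. ennreal (c z + 2 * N) \<partial>\<sigma>n) = (\<integral>\<^sup>+z. g z \<partial>\<sigma>n)"
  proof (rule nn_integral_cong_AE)
    show "AE z in \<sigma>n. ennreal (c z + 2 * N) = g z"
      using AE_box[OF s(2) K(3)] line
    proof eventually_elim
      case (elim z)
      then have "p (fst z) + q (snd z - \<theta>) = c z" using eq[of "fst z"] by (cases z) auto
      then show ?case using g_eq[of z] elim(1) by simp
    qed
  qed
  also have "\<dots> = (\<integral>\<^sup>+z. g z \<partial>\<sigma>p)"
    unfolding int_g[OF s(1)] int_g[OF s(2)]
    using nn_integral_fst_snd_eq(1)[OF s mp m0] nn_integral_fst_snd_eq(2)[OF s mq m1] by simp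
  also have "\<dots> \<le> (\<integral>\<^sup>+z. ennreal (c z + 2 * N) \<partial>\<sigma>p)"
  proof (rule nn_integral_mono_AE)
    show "AE z in \<sigma>p. g z \<le> ennreal (c z + 2 * N)"
      using AE_box[OF s(1) K(2)]
    proof eventually_elim
      case (elim z)
      then have "p (fst z) + q (snd z - \<theta>) \<le> c z" using le[of "fst z" "snd z - \<theta>"] by simp
      then show ?case using g_eq[OF elim] by (simp add: ennreal_leI)
    qed
  qed
  finally show ?thesis
    using signed_integral_neg_iff[OF c s fin _ AE_below AE_below'] m0[of UNIV] N(3) by (simp add: not_less)
qed

lemma compact_finite_diff_marginals:
  assumes tp: "transport_plan \<mu>0 \<mu>1 \<gamma>" "transport_plan \<mu>0 \<mu>1 \<gamma>'"
    and diff: "compact_finite_diff \<gamma>' \<gamma> \<sigma>p \<sigma>n" and A: "A \<in> sets borel"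
  shows "emeasure \<sigma>p (A \<times> UNIV) = emeasure \<sigma>n (A \<times> UNIV)"
    and "emeasure \<sigma>p (UNIV \<times> A) = emeasure \<sigma>n (UNIV \<times> A)"
proof -
  have s: "sets \<sigma>p = sets borel" "sets \<sigma>n = sets borel"
    and eq: "\<And>X. X \<in> sets borel \<Longrightarrow> emeasure \<gamma>' X + emeasure \<sigma>n X = emeasure \<gamma> X + emeasure \<sigma>p X"
    using diff by (auto simp: compact_finite_diff_def)
  obtain K where K: "compact K" "emeasure \<sigma>p (- K) = 0" "emeasure \<sigma>n (- K) = 0"
    using diff by (auto simp: compact_finite_diff_def)
  obtain r where r: "K \<subseteq> {-r..r} \<times> {-r..r}" using compact_subset_square[OF K(1)] by metis
  have lf: "locally_finite_measure \<mu>0" "locally_finite_measure \<mu>1" using tp(1) by (simp_all add: transport_plan_def)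
  have Kb: "- K \<in> sets borel" using K(1) by (simp add: borel_comp borel_compact)
  have restrict: "emeasure \<sigma> X = emeasure \<sigma> Y"
    if "sets \<sigma> = sets borel" "emeasure \<sigma> (- K) = 0" "X \<in> sets borel" "Y \<in> sets borel" "X \<inter> K = Y \<inter> K" for \<sigma> X Y
  proof (rule emeasure_eq_AE)
    have "AE z in \<sigma>. z \<notin> - K" using that Kb by (intro AE_not_in null_setsI) auto
    then show "AE z in \<sigma>. (z \<in> X) = (z \<in> Y)" by eventually_elim (use that(5) in blast)
  qed (use that in auto)
  have cancel: "emeasure \<sigma>p X = emeasure \<sigma>n X"
    if "X \<in> sets borel" "emeasure \<gamma>' X = emeasure \<gamma> X" "emeasure \<gamma> X < \<infinity>" for X
    using eq[OF that(1)] that(2,3) by (auto simp: ennreal_add_left_cancel)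
  let ?B = "A \<inter> {-r..r}"
  have B: "?B \<in> sets borel" using A by auto
  have finB: "emeasure \<mu> ?B < \<infinity>" if "locally_finite_measure \<mu>" for \<mu>
  proof -
    have "emeasure \<mu> ?B \<le> emeasure \<mu> {-r..r}"
      using that by (intro emeasure_mono) (auto simp: locally_finite_measure_def)
    then show ?thesis using emeasure_Icc_finite[OF that, of "-r" r] by (rule le_less_trans)
  qed
  have "emeasure \<sigma>p (?B \<times> UNIV) = emeasure \<sigma>n (?B \<times> UNIV)"
    using B finB[OF lf(1)] transport_planD(3)[OF tp(1) B] transport_planD(3)[OF tp(2) B]
    by (intro cancel) (auto simp: borel_Times)
  moreover have "A \<times> UNIV \<inter> K = ?B \<times> UNIV \<inter> K" using r by auto
  ultimately show "emeasure \<sigma>p (A \<times> UNIV) = emeasure \<sigma>n (A \<times> UNIV)"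
    using restrict[OF s(1) K(2), of "A \<times> UNIV" "?B \<times> UNIV"] restrict[OF s(2) K(3), of "A \<times> UNIV" "?B \<times> UNIV"] A B
    by (simp add: borel_Times)
  have "emeasure \<sigma>p (UNIV \<times> ?B) = emeasure \<sigma>n (UNIV \<times> ?B)"
    using B finB[OF lf(2)] transport_planD(4)[OF tp(1) B] transport_planD(4)[OF tp(2) B]
    by (intro cancel) (auto simp: borel_Times)
  moreover have "UNIV \<times> A \<inter> K = UNIV \<times> ?B \<inter> K" using r by auto
  ultimately show "emeasure \<sigma>p (UNIV \<times> A) = emeasure \<sigma>n (UNIV \<times> A)"
    using restrict[OF s(1) K(2), of "UNIV \<times> A" "UNIV \<times> ?B"] restrict[OF s(2) K(3), of "UNIV \<times> A" "UNIV \<times> ?B"] A B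
    by (simp add: borel_Times)
qed

text \<open>The removed part of a local modification is dominated by the plan, by mutual singularity.\<close>

lemma compact_finite_diff_null:
  assumes s': "sets \<gamma> = sets borel"
    and diff: "compact_finite_diff \<gamma>' \<gamma> \<sigma>p \<sigma>n" and X: "X \<in> sets borel" "emeasure \<gamma> X = 0"
  shows "emeasure \<sigma>n X = 0"
proof -
  have s: "sets \<sigma>p = sets borel" "sets \<sigma>n = sets borel"
    and eq: "\<And>X. X \<in> sets borel \<Longrightarrow> emeasure \<gamma>' X + emeasure \<sigma>n X = emeasure \<gamma> X + emeasure \<sigma>p X"
    using diff by (auto simp: compact_finite_diff_def)
  obtain S where S: "S \<in> sets borel" "emeasure \<sigma>p (- S) = 0" "emeasure \<sigma>n S = 0"
    using diff by (auto simp: compact_finite_diff_def)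
  have mS: "X - S \<in> sets borel" "- S \<in> sets borel" "X \<union> S \<in> sets borel"
    using X S by (auto intro: borel_comp)
  have "emeasure \<gamma> (X - S) \<le> emeasure \<gamma> X" using X s' by (intro emeasure_mono) auto
  moreover have "emeasure \<sigma>p (X - S) \<le> emeasure \<sigma>p (- S)" using mS s by (intro emeasure_mono) auto
  ultimately have "emeasure \<sigma>n (X - S) = 0" using eq[OF mS(1)] X S by simp
  moreover have "emeasure \<sigma>n X \<le> emeasure \<sigma>n (X - S \<union> S)"
    using mS S s by (intro emeasure_mono) auto
  moreover have "\<dots> \<le> emeasure \<sigma>n (X - S) + emeasure \<sigma>n S"
    using mS S s by (intro emeasure_subadditive) auto
  ultimately show ?thesis using S by simp
qed

context two_unit_mass_measures
begin

lemma shift_plan_locally_optimal: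
  assumes c: "lower_semicontinuous c" "monge c" and sh: "shift_plan \<theta> \<nu>"
  shows "locally_optimal lborel lborel (conjugate_cost \<mu>0 \<mu>1 c) \<nu>"
  unfolding locally_optimal_def
proof (intro conjI notI)
  show tp: "transport_plan lborel lborel \<nu>" using sh by (simp add: shift_plan_def normal_plan_def)
  assume "\<exists>\<nu>'. local_modification lborel lborel \<nu> \<nu>' \<and> cost_reducing (conjugate_cost \<mu>0 \<mu>1 c) \<nu> \<nu>'"
  then obtain \<nu>' \<sigma>p \<sigma>n where tp': "transport_plan lborel lborel \<nu>'"
    and diff: "compact_finite_diff \<nu>' \<nu> \<sigma>p \<sigma>n"
    and neg: "signed_integral_neg (conjugate_cost \<mu>0 \<mu>1 c) \<sigma>p \<sigma>n"
    by (auto simp: local_modification_def cost_reducing_def)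
  have s: "sets \<sigma>p = sets borel" "sets \<sigma>n = sets borel" "finite_measure \<sigma>p" "finite_measure \<sigma>n"
    using diff by (auto simp: compact_finite_diff_def)
  obtain K where K: "compact K" "emeasure \<sigma>p (- K) = 0" "emeasure \<sigma>n (- K) = 0"
    using diff by (auto simp: compact_finite_diff_def)
  let ?l = "{(v, w). w = v + \<theta>}"
  have "closed {z :: real \<times> real. snd z = fst z + \<theta>}"
    by (intro closed_Collect_eq continuous_intros)
  then have l: "- ?l \<in> sets borel" by (simp add: case_prod_beta' borel_comp borel_closed)
  have "emeasure \<nu> (- ?l) = 0"
    using emeasure_Compl_measure_support[OF transport_planD(1)[OF tp]] sh by (simp add: shift_plan_def)
  then have "emeasure \<sigma>n (- ?l) = 0" by (rule compact_finite_diff_null[OF transport_planD(1)[OF tp] diff l])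
  then have "AE (v, w) in \<sigma>n. w = v + \<theta>"
    using l s by (intro AE_I[of _ _ "- ?l"]) auto
  from not_signed_integral_neg_of_line[OF conjugate_cost_measurable conjugate_cost_monge[OF c(2)]
      conjugate_cost_bounded_below[OF c(1)] s K compact_finite_diff_marginals[OF tp tp' diff] this]
  show False using neg borel_measurable_lower_semicontinuous[OF c(1)] by blast
qed

end

lemma unit_mass_measureI:
  assumes "periodic_measure \<mu>" "unit_mass_per_period \<mu>"
  shows "unit_mass_measure \<mu>"
  using assms by (simp add: unit_mass_measure_def periodic_measure_def unit_mass_per_period_def)

theorem theorem8:
  fixes \<mu>0 \<mu>1 :: "real measure" and c :: "real \<times> real \<Rightarrow> real"
  assumes "periodic_measure \<mu>0" and "unit_mass_per_period \<mu>0"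
    and "periodic_measure \<mu>1" and "unit_mass_per_period \<mu>1"
    and "lower_semicontinuous c" and "monge c"
  shows "(\<forall>\<nu>. locally_optimal lborel lborel (conjugate_cost \<mu>0 \<mu>1 c) \<nu> \<longrightarrow>
            (\<exists>\<theta> \<nu>\<theta>. shift_plan \<theta> \<nu>\<theta> \<and> equivalent_plans \<mu>0 \<mu>1 \<nu> \<nu>\<theta>))
       \<and> (\<forall>\<theta>. (\<exists>\<nu>\<theta>. shift_plan \<theta> \<nu>\<theta>) \<and>
            (\<forall>\<nu>\<theta>. shift_plan \<theta> \<nu>\<theta> \<longrightarrow>
               locally_optimal lborel lborel (conjugate_cost \<mu>0 \<mu>1 c) \<nu>\<theta>))
       \<and> (\<forall>\<gamma>. locally_optimal \<mu>0 \<mu>1 c \<gamma> \<longrightarrow>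
            (\<exists>\<theta> \<nu>\<theta>. shift_plan \<theta> \<nu>\<theta> \<and> conjugate_plan \<mu>0 \<mu>1 \<nu>\<theta> \<gamma>))"
proof -
  interpret two_unit_mass_measures \<mu>0 \<mu>1
    unfolding two_unit_mass_measures_def using assms by (simp add: unit_mass_measureI)
  show ?thesis
    using locally_optimal_normal_equivalent_shift[OF assms(5,6)] locally_optimal_conjugate_shift[OF assms(5,6)]
      shift_plan_locally_optimal[OF assms(5,6)] shift_plan_shift_measure
    by blast
qed

end
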